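(* Let $G$ be a finite group, $p$ a prime dividing $|G|$, $k$ an algebraically closed field of characteristic $p$, $S$ a Sylow $p$-subgroup of $G$, and $n\ge 1$ an integer. Let $A_n(G,S)$ be the set of weak $n$-homomorphisms $G\to \mathrm{GL}_n(k)$. Then the restriction of functions from $G$ to $N_G(S)$ induces a bijection \[ A_n(G,S)\to \mathrm{Hom}(N_G(S)/K_G,\mathrm{GL}_n(k)),\] where $K_G\trianglelefteq N_G(S)$ is the subgroup defined in the context.
   Context: Notation: $x^g=g^{-1}xg$ and $S^g=g^{-1}Sg$; $O^{p'}(H)$ is the smallest normal subgroup of $H$ with index prime to $p$, i.e. the subgroup generated by all $p$-elements of $H$. A function $\rho:G\to \mathrm{GL}_n(k)$ is a weak $n$-homomorphism if: $\rho(x)$ is the identity matrix whenever $S\cap S^x=1$ or $x$ is a $p$-element normalizing some non-trivial subgroup of $S$; and $\rho(x)\rho(y)=\rho(xy)$ whenever $S\cap S^y\cap S^{xy}\neq 1$. $K_G$ is the subgroup of $N_G(S)$ generated by all elements $g\in N_G(S)$ for which there exist $m\ge 1$, elements $x_1,\dots,x_m,y\in G$ with $y\neq 1$, and non-trivial subgroups $Q_1,\dots,Q_m$ of $S$ such that: $g=x_1\cdots x_m$; $x_i\in O^{p'}(N_G(Q_i))$ for all $1\le i\le m$; and $y^{x_1\cdots x_i}$ lies in both $Q_i$ and $Q_{i+1}$ for all $1\le i<m$. It is normal in $N_G(S)$. *)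

theory Defs
  imports "HOL-Computational_Algebra.Polynomial" "HOL-Algebra.Algebra" "Jordan_Normal_Form.Matrix"
begin

(* HOL-Algebra's prime (of a monoid) would otherwise shadow the prime numbers. *)
hide_const (open) Divisibility.prime

definition conj_elt :: "('a, 'b) monoid_scheme \<Rightarrow> 'a \<Rightarrow> 'a \<Rightarrow> 'a" where
  "conj_elt G y g = inv\<^bsub>G\<^esub> g \<otimes>\<^bsub>G\<^esub> y \<otimes>\<^bsub>G\<^esub> g"

definition conj_set :: "('a, 'b) monoid_scheme \<Rightarrow> 'a set \<Rightarrow> 'a \<Rightarrow> 'a set" where
  "conj_set G S g = (\<lambda>s. conj_elt G s g) ` S"

definition sylow_subgroup :: "nat \<Rightarrow> ('a, 'b) monoid_scheme \<Rightarrow> 'a set \<Rightarrow> bool" where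
  "sylow_subgroup p G S \<longleftrightarrow> subgroup S G \<and> card S = p ^ multiplicity p (order G)"

definition p_elements :: "nat \<Rightarrow> ('a, 'b) monoid_scheme \<Rightarrow> 'a set" where
  "p_elements p G = {x \<in> carrier G. \<exists>k. group.ord G x = p ^ k}"

definition nontriv_subgroups :: "('a, 'b) monoid_scheme \<Rightarrow> 'a set \<Rightarrow> 'a set set" where
  "nontriv_subgroups G S = {Q. subgroup Q G \<and> Q \<subseteq> S \<and> Q \<noteq> {\<one>\<^bsub>G\<^esub>}}"

(* O^{p'}(H), for p prime and H finite: the smallest normal subgroup of index prime to p.
   That the intersection itself has index prime to p follows from O_pprime_eq_generate. *)
definition O_pprime :: "nat \<Rightarrow> ('a, 'b) monoid_scheme \<Rightarrow> 'a set" where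
  "O_pprime p H = \<Inter> {N. N \<lhd> H \<and> coprime p (card (rcosets\<^bsub>H\<^esub> N))}"

(* The group with carrier the normalizer of Q in G (HOL-Algebra's normalizer is only a set). *)
abbreviation normalizer_group :: "('a, 'b) monoid_scheme \<Rightarrow> 'a set \<Rightarrow> ('a, 'b) monoid_scheme" where
  "normalizer_group G Q \<equiv> G\<lparr>carrier := normalizer G Q\<rparr>"

(* x 1 \<otimes> ... \<otimes> x i, which is \<one> for i = 0 *)
definition partial_prod :: "('a, 'b) monoid_scheme \<Rightarrow> (nat \<Rightarrow> 'a) \<Rightarrow> nat \<Rightarrow> 'a" where
  "partial_prod G x i = foldr (\<otimes>\<^bsub>G\<^esub>) (map x [1..<Suc i]) \<one>\<^bsub>G\<^esub>"

definition K_gens :: "('a, 'b) monoid_scheme \<Rightarrow> nat \<Rightarrow> 'a set \<Rightarrow> 'a set" where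
  "K_gens G p S = {g \<in> normalizer G S.
     \<exists>(m::nat) (x :: nat \<Rightarrow> 'a) (y :: 'a) (Q :: nat \<Rightarrow> 'a set).
       m \<ge> 1 \<and> (\<forall>i\<in>{1..m}. x i \<in> carrier G) \<and> y \<in> carrier G \<and> y \<noteq> \<one>\<^bsub>G\<^esub> \<and>
       (\<forall>i\<in>{1..m}. Q i \<in> nontriv_subgroups G S) \<and>
       g = partial_prod G x m \<and>
       (\<forall>i\<in>{1..m}. x i \<in> O_pprime p (normalizer_group G (Q i))) \<and>
       (\<forall>i\<in>{1..<m}. conj_elt G y (partial_prod G x i) \<in> Q i \<inter> Q (i + 1))}"

definition K_group :: "('a, 'b) monoid_scheme \<Rightarrow> nat \<Rightarrow> 'a set \<Rightarrow> 'a set" where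
  "K_group G p S = generate (normalizer_group G S) (K_gens G p S)"

definition GL :: "nat \<Rightarrow> ('k::field) mat monoid" where
  "GL n = units_of (ring_mat TYPE('k) n ())"

(* Functions and homomorphisms are taken extensional (undefined off the carrier), so that
   equality in HOL is equality of functions on the carrier. *)
definition weak_homs ::
    "('a, 'b) monoid_scheme \<Rightarrow> nat \<Rightarrow> 'a set \<Rightarrow> nat \<Rightarrow> ('a \<Rightarrow> ('k::field) mat) set" where
  "weak_homs G p S n = {\<rho> \<in> carrier G \<rightarrow>\<^sub>E carrier (GL n).
     (\<forall>x\<in>carrier G.
        S \<inter> conj_set G S x = {\<one>\<^bsub>G\<^esub>} \<or>
        (x \<in> p_elements p G \<and> (\<exists>Q\<in>nontriv_subgroups G S. x \<in> normalizer G Q))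
        \<longrightarrow> \<rho> x = 1\<^sub>m n) \<and>
     (\<forall>x\<in>carrier G. \<forall>y\<in>carrier G.
        S \<inter> conj_set G S y \<inter> conj_set G S (x \<otimes>\<^bsub>G\<^esub> y) \<noteq> {\<one>\<^bsub>G\<^esub>}
        \<longrightarrow> \<rho> x * \<rho> y = \<rho> (x \<otimes>\<^bsub>G\<^esub> y))}"

definition Hom :: "('a, 'b) monoid_scheme \<Rightarrow> ('c, 'd) monoid_scheme \<Rightarrow> ('a \<Rightarrow> 'c) set" where
  "Hom G H = hom G H \<inter> extensional (carrier G)"

lemma group_GL: "group (GL n :: ('k::field) mat monoid)"
proof -
  interpret R: ring "ring_mat TYPE('k) n ()" by (rule ring_mat)
  show ?thesis unfolding GL_def by (rule R.units_group)
qed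

lemma carrier_GL:
  "carrier (GL n :: ('k::field) mat monoid) = {A \<in> carrier_mat n n. invertible_mat A}"
proof -
  have "\<exists>B\<in>carrier_mat n n. B * A = 1\<^sub>m n \<and> A * B = 1\<^sub>m n"
    if A: "A \<in> carrier_mat n n" "A * B = 1\<^sub>m (dim_row A)" "B * A = 1\<^sub>m (dim_row B)"
    for A B :: "'k mat"
  proof -
    have "dim_col B = n" using A(1,2) by (metis carrier_matD(1) index_mult_mat(3) index_one_mat(3))
    moreover have "dim_row B = n" using A(1,3)
      by (metis carrier_matD(2) index_mult_mat(3) index_one_mat(3))
    ultimately show ?thesis using A by (intro bexI[of _ B]) auto
  qed
  then show ?thesis
    unfolding GL_def units_of_def Units_def invertible_mat_def inverts_mat_def
    by (auto simp: ring_mat_simps)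
qed

lemma conj_set_eq: "conj_set G S g = inv\<^bsub>G\<^esub> g <#\<^bsub>G\<^esub> S #>\<^bsub>G\<^esub> g"
  by (auto simp: conj_set_def conj_elt_def l_coset_def r_coset_def)

lemma O_pprime_eq_generate:
  fixes G (structure)
  assumes "group G" "finite (carrier G)" "prime p"
  shows "O_pprime p G = generate G (p_elements p G)"
proof
  interpret group G by fact
  let ?P = "p_elements p G"
  let ?N = "generate G ?P"
  have P: "?P \<subseteq> carrier G" by (auto simp: p_elements_def)
  have subN: "subgroup ?N G" using P by (rule generate_is_subgroup)
  have conjP: "g \<otimes> h \<otimes> inv g \<in> ?P" if h: "h \<in> ?P" and g: "g \<in> carrier G" for h g
  proof -
    have hG: "h \<in> carrier G" using h P by auto
    have pow: "(g \<otimes> h \<otimes> inv g) [^] (i::nat) = g \<otimes> h [^] i \<otimes> inv g" for i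
    proof (induction i)
      case (Suc i)
      have "g \<otimes> h [^] i \<otimes> inv g \<otimes> (g \<otimes> h \<otimes> inv g)
          = g \<otimes> h [^] i \<otimes> (inv g \<otimes> g) \<otimes> h \<otimes> inv g"
        using g hG by (simp add: m_assoc inv_solve_left')
      then show ?case using Suc g hG by (simp add: m_assoc inv_solve_left')
    qed (use g in auto)
    have "(g \<otimes> h \<otimes> inv g) [^] i = \<one> \<longleftrightarrow> h [^] i = \<one>" for i :: nat
      unfolding pow using g hG by (simp add: inv_solve_right')
    then have "ord (g \<otimes> h \<otimes> inv g) = ord h" by (simp add: ord_def)
    then show ?thesis using h g hG by (auto simp: p_elements_def)
  qed
  have norm: "?N \<lhd> G" by (rule normal_generateI[OF P conjP])
  have lag: "card (rcosets ?N) * card ?N = order G" using lagrange[OF subN] .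
  have ord0: "order G > 0" using assms(2) by (simp add: order_gt_0_iff_finite)
  let ?a = "multiplicity p (order G)"
  obtain m where m: "order G = p ^ ?a * m" using multiplicity_dvd by (metis dvdE)
  obtain S where S: "subgroup S G" "card S = p ^ ?a"
    using sylow_thm[OF assms(3) assms(1) m assms(2)] by auto
  have "S \<subseteq> ?P"
  proof
    fix x assume x: "x \<in> S"
    then have xG: "x \<in> carrier G" using S(1) subgroup.subset by auto
    interpret SG: group "G\<lparr>carrier := S\<rparr>" using S(1) by (rule subgroup_imp_group)
    have "x [^]\<^bsub>G\<lparr>carrier := S\<rparr>\<^esub> order (G\<lparr>carrier := S\<rparr>) = \<one>\<^bsub>G\<lparr>carrier := S\<rparr>\<^esub>"
      using x by (intro SG.pow_order_eq_1) simp
    then have "x [^] (p ^ ?a) = \<one>"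
      using S(2) by (simp add: order_def nat_pow_def)
    then have "ord x dvd p ^ ?a" using xG by (simp add: pow_eq_id)
    then show "x \<in> ?P" using xG assms(3) by (auto simp: p_elements_def divides_primepow_nat)
  qed
  then have SN: "S \<subseteq> ?N" by (auto intro: generate.incl)
  have "subgroup S (G\<lparr>carrier := ?N\<rparr>)" using S(1) subN SN by (rule subgroup_incl)
  then have "card (rcosets\<^bsub>G\<lparr>carrier := ?N\<rparr>\<^esub> S) * card S = card ?N"
    using group.lagrange[OF subgroup_imp_group[OF subN]] by (simp add: order_def)
  then have "card S dvd card ?N" by (metis dvd_triv_right)
  then have "p ^ ?a dvd card ?N" using S by simp
  have "\<not> p dvd card (rcosets ?N)"
  proof
    assume "p dvd card (rcosets ?N)"
    then have "p * p ^ ?a dvd card (rcosets ?N) * card ?N"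
      using \<open>p ^ ?a dvd card ?N\<close> by (rule mult_dvd_mono)
    then have "p ^ Suc ?a dvd order G" by (simp add: lag)
    moreover have "\<not> is_unit p" using assms(3) not_prime_unit by blast
    ultimately show False using ord0 multiplicity_geI[of "order G" p "Suc ?a"] by simp
  qed
  then have "coprime p (card (rcosets ?N))" using assms(3) by (simp add: prime_imp_coprime)
  then show "O_pprime p G \<subseteq> ?N" using norm unfolding O_pprime_def by blast
  show "?N \<subseteq> O_pprime p G"
    unfolding O_pprime_def
  proof (rule Inter_greatest, clarify)
    fix N x assume N: "N \<lhd> G" and cop: "coprime p (card (rcosets N))" and x: "x \<in> ?N"
    interpret N: normal N G by fact
    interpret Q: group "G Mod N" by (rule N.factorgroup_is_group)
    have "?P \<subseteq> N"
    proof
      fix x assume "x \<in> ?P"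
      then obtain k where xG: "x \<in> carrier G" and k: "ord x = p ^ k" by (auto simp: p_elements_def)
      have X: "N #> x \<in> carrier (G Mod N)" using xG by (auto simp: FactGroup_def RCOSETS_def)
      have hom: "(\<lambda>a. N #> a) \<in> hom G (G Mod N)" by (rule N.r_coset_hom_Mod)
      interpret h: group_hom G "G Mod N" "\<lambda>a. N #> a"
        by unfold_locales (rule hom)
      have "(N #> x) [^]\<^bsub>G Mod N\<^esub> (p ^ k) = N #> (x [^] (p ^ k))"
        using xG by (rule h.hom_nat_pow[symmetric])
      also have "\<dots> = \<one>\<^bsub>G Mod N\<^esub>" using k xG h.hom_one by (metis pow_ord_eq_1)
      finally have "Q.ord (N #> x) dvd p ^ k" using Q.pow_eq_id[OF X] by blast
      moreover have "Q.ord (N #> x) dvd card (rcosets N)"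
        using Q.ord_dvd_group_order[OF X] by (simp add: order_def FactGroup_def)
      moreover have "coprime (p ^ k) (card (rcosets N))" using cop by simp
      ultimately have "Q.ord (N #> x) = 1" by (rule coprime_common_divisor_nat[rotated])
      then have "N #> x = \<one>\<^bsub>G Mod N\<^esub>" using X Q.ord_eq_1 by blast
      then have "N #> x = N" by simp
      then show "x \<in> N" using rcos_self[OF xG N.subgroup_axioms] by simp
    qed
    then show "x \<in> N" using x generate_subgroup_incl[OF _ N.subgroup_axioms] by blast
  qed
qed

end

theory Submission
  imports Defs
begin

text \<open>
  A weak homomorphism is trivial on every \<open>O\<^sup>p\<^sup>'(N\<^sub>G(Q))\<close> with \<open>1 \<noteq> Q \<le> S\<close>. By a form of Alperin's
  fusion theorem, every \<open>x\<close> for which some \<open>y \<in> S\<close>, \<open>y \<noteq> 1\<close>, has \<open>y\<^sup>x \<in> S\<close> can be written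
  \<open>x = w h\<close> with \<open>h \<in> N\<^sub>G(S)\<close> and \<open>w\<close> a product of elements of such subgroups along which the
  conjugates of \<open>y\<close> stay in \<open>S\<close>. Hence \<open>\<rho> x = \<rho> h\<close>, so \<open>\<rho>\<close> is determined by its restriction to
  \<open>N\<^sub>G(S)\<close>. Two choices of \<open>h\<close> for the same \<open>y\<close> differ by a generator of \<open>K\<^sub>G\<close>, and one \<open>h\<close> works for
  all \<open>y \<in> S\<close> with \<open>y\<^sup>x \<in> S\<close>, so the coset of \<open>h\<close> modulo \<open>K\<^sub>G\<close> depends on \<open>x\<close> only. Therefore a
  homomorphism on \<open>N\<^sub>G(S)/K\<^sub>G\<close> extends to \<open>G\<close> by the same formula.
\<close>

section \<open>Fixed points of p-groups and conjugation\<close>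

lemma prime_dvd_if_dvd_prime_power:
  fixes p :: nat
  assumes p: "prime p" and dvd: "n dvd p ^ k" and "n \<noteq> 1"
  shows "p dvd n"
proof -
  obtain i where "n = p ^ i" using dvd p by (auto simp: divides_primepow_nat)
  then show ?thesis using \<open>n \<noteq> 1\<close> by (cases i) auto
qed

text \<open>Orbit sizes divide p^k. The non-fixed points form a union of orbits with more than one
  element, and each of these has size divisible by p.\<close>

lemma (in group_action) prime_dvd_card_non_fixed:
  assumes p: "prime p" and ord: "order G = p ^ k" and E: "finite E"
  shows "p dvd card {x \<in> E. \<exists>g\<in>carrier G. \<phi> g x \<noteq> x}"
proof -
  interpret group G using group_hom by (rule group_hom.axioms)
  \<comment> \<open>The indicator function of the non-fixed points: its sum over \<open>E\<close>
    counts them, and that sum splits along the orbits. An orbit containing a fixed point is a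
    singleton and contributes 0; any other contributes its size.\<close>
  let ?f = "\<lambda>x. if \<exists>g\<in>carrier G. \<phi> g x \<noteq> x then 1 else 0::nat"
  have "p dvd (\<Sum>x\<in>orb. ?f x)" if "orb \<in> orbits G E \<phi>" for orb
  proof -
    obtain x where x: "x \<in> E" and orb: "orb = orbit G \<phi> x"
      using \<open>orb \<in> orbits G E \<phi>\<close> by (auto simp: orbits_def)
    have card: "card orb dvd p ^ k"
      using orbit_stabilizer_theorem[OF x] ord orb by (metis dvd_triv_left)
    have sub: "orb \<subseteq> E" using orb x element_image by (auto simp: orbit_def)
    show ?thesis
    proof (cases "\<exists>y\<in>orb. \<forall>g\<in>carrier G. \<phi> g y = y")
      case True
      then obtain y where y: "y \<in> orb" "\<forall>g\<in>carrier G. \<phi> g y = y" by blast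
      have "x \<in> orbit G \<phi> y" using orbit_sym[OF x] y(1) sub orb by blast
      then have "x = y" using y(2) by (auto simp: orbit_def)
      then have "orb = {x}" using orb y(2) orbit_refl[OF x] by (auto simp: orbit_def)
      then show ?thesis using \<open>x = y\<close> y(2) by simp
    next
      case False
      then have "(\<Sum>x\<in>orb. ?f x) = card orb" by simp
      moreover have "card orb \<noteq> 1"
      proof
        assume "card orb = 1"
        then obtain z where z: "orb = {z}" by (auto simp: card_1_singleton_iff)
        then have "z = x" using orbit_refl[OF x] orb by simp
        then have "\<forall>g\<in>carrier G. \<phi> g x = x" using z orb by (auto simp: orbit_def)
        then show False using False z \<open>z = x\<close> by simp
      qed
      ultimately show ?thesis using prime_dvd_if_dvd_prime_power[OF p card] by simp
    qed
  qed
  then have "p dvd (\<Sum>orb\<in>orbits G E \<phi>. \<Sum>x\<in>orb. ?f x)" by (rule dvd_sum)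
  moreover have "(\<Sum>x\<in>E. ?f x) = card {x \<in> E. \<exists>g\<in>carrier G. \<phi> g x \<noteq> x}"
    by (rule card_as_sums[symmetric, OF refl E])
  ultimately show ?thesis using disjoint_sum[OF E, of ?f] by simp
qed

context group
begin

text \<open>The inverse turns right multiplication into a homomorphism to \<open>BijGroup\<close>;
  the restriction to the set of cosets is there because elements of \<open>Bij\<close> are
  extensional.\<close>

lemma rcosets_action:
  assumes T: "subgroup T G"
  shows "group_action G (rcosets T) (\<lambda>g. \<lambda>C\<in>rcosets T. C #> inv g)"
proof -
  let ?\<phi> = "\<lambda>g. \<lambda>C\<in>rcosets T. C #> inv g"
  have TG: "T \<subseteq> carrier G" using T by (rule subgroup.subset)
  have cl: "C #> g \<in> rcosets T" if "C \<in> rcosets T" "g \<in> carrier G" for C g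
    using that TG by (auto simp: RCOSETS_def coset_mult_assoc)
  have sub: "C \<subseteq> carrier G" if "C \<in> rcosets T" for C
    using that T by (meson group_axioms subgroup.rcosets_carrier)
  have bij: "?\<phi> g \<in> Bij (rcosets T)" if g: "g \<in> carrier G" for g
  proof -
    have "bij_betw (?\<phi> g) (rcosets T) (rcosets T)"
      by (rule bij_betw_byWitness[where f' = "\<lambda>C. C #> g"])
         (use g cl sub in \<open>auto simp: coset_mult_assoc\<close>)
    then show ?thesis by (simp add: Bij_def)
  qed
  have "?\<phi> \<in> hom G (BijGroup (rcosets T))"
  proof (rule homI)
    fix g h assume gh: "g \<in> carrier G" "h \<in> carrier G"
    have "?\<phi> (g \<otimes> h) = compose (rcosets T) (?\<phi> g) (?\<phi> h)"
      using gh cl sub by (auto simp: compose_def fun_eq_iff coset_mult_assoc inv_mult_group)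
    then show "?\<phi> (g \<otimes> h) = ?\<phi> g \<otimes>\<^bsub>BijGroup (rcosets T)\<^esub> ?\<phi> h"
      using bij gh by (simp add: BijGroup_def)
  qed (use bij in \<open>simp add: BijGroup_def\<close>)
  then show ?thesis
    by (simp add: group_action_def group_hom_def group_hom_axioms_def group_BijGroup is_group)
qed

text \<open>The orbit count for the coset action restricted to \<open>U\<close>. The inverse in the
  action disappears because \<open>U\<close> is closed under inverses.\<close>

lemma prime_dvd_card_non_fixed_rcosets:
  assumes fin: "finite (carrier G)" and p: "prime p"
    and T: "subgroup T G" and U: "subgroup U G" "card U = p ^ k"
  shows "p dvd card {C \<in> rcosets T. \<exists>u\<in>U. C #> u \<noteq> C}"
proof -
  interpret A: group_action "G\<lparr>carrier := U\<rparr>" "rcosets T" "\<lambda>g. \<lambda>C\<in>rcosets T. C #> inv g"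
    using group_action.induced_action[OF rcosets_action[OF T] U(1)] .
  have "finite (rcosets T)" using fin rcosets_subset_PowG[OF T] by (meson finite_Pow_iff finite_subset)
  then have "p dvd card {C \<in> rcosets T. \<exists>u\<in>U. (\<lambda>C\<in>rcosets T. C #> inv u) C \<noteq> C}"
    using A.prime_dvd_card_non_fixed[OF p, of k] U(2) by (simp add: order_def)
  also have "{C \<in> rcosets T. \<exists>u\<in>U. (\<lambda>C\<in>rcosets T. C #> inv u) C \<noteq> C}
      = {C \<in> rcosets T. \<exists>u\<in>U. C #> u \<noteq> C}"
  proof -
    have "\<exists>u\<in>U. C #> inv u \<noteq> C" if "u \<in> U" "C #> u \<noteq> C" for C u
      using that subgroup.m_inv_closed[OF U(1)] subgroup.mem_carrier[OF U(1)]
      by (intro bexI[where x = "inv u"]) simp_all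
    then have "(\<exists>u\<in>U. C #> inv u \<noteq> C) \<longleftrightarrow> (\<exists>u\<in>U. C #> u \<noteq> C)" for C
      using subgroup.m_inv_closed[OF U(1)] by auto
    then show ?thesis by (simp cong: conj_cong)
  qed
  finally show ?thesis .
qed

section \<open>Conjugation of elements and subgroups\<close>

lemma conj_elt_closed [simp]:
  "y \<in> carrier G \<Longrightarrow> g \<in> carrier G \<Longrightarrow> conj_elt G y g \<in> carrier G"
  by (simp add: conj_elt_def)

lemma conj_elt_one [simp]: "y \<in> carrier G \<Longrightarrow> conj_elt G y \<one> = y"
  by (simp add: conj_elt_def)

lemma one_conj_elt [simp]: "g \<in> carrier G \<Longrightarrow> conj_elt G \<one> g = \<one>"
  by (simp add: conj_elt_def)

lemma conj_elt_conj_elt: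
  "y \<in> carrier G \<Longrightarrow> g \<in> carrier G \<Longrightarrow> h \<in> carrier G \<Longrightarrow>
    conj_elt G (conj_elt G y g) h = conj_elt G y (g \<otimes> h)"
  by (simp add: conj_elt_def m_assoc inv_mult_group)

lemma mult_inv_cancel: "g \<in> carrier G \<Longrightarrow> z \<in> carrier G \<Longrightarrow> g \<otimes> (inv g \<otimes> z) = z"
  by (simp add: m_assoc[symmetric])

lemma inv_mult_cancel: "g \<in> carrier G \<Longrightarrow> z \<in> carrier G \<Longrightarrow> inv g \<otimes> (g \<otimes> z) = z"
  by (simp add: m_assoc[symmetric])

lemma conj_elt_mult:
  "y \<in> carrier G \<Longrightarrow> z \<in> carrier G \<Longrightarrow> g \<in> carrier G \<Longrightarrow>
    conj_elt G (y \<otimes> z) g = conj_elt G y g \<otimes> conj_elt G z g"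
  by (simp add: conj_elt_def m_assoc mult_inv_cancel)

lemma conj_elt_inv:
  "y \<in> carrier G \<Longrightarrow> g \<in> carrier G \<Longrightarrow> conj_elt G (inv y) g = inv (conj_elt G y g)"
  by (simp add: conj_elt_def m_assoc inv_mult_group)

lemma conj_elt_eq_one_iff:
  assumes "y \<in> carrier G" "g \<in> carrier G"
  shows "conj_elt G y g = \<one> \<longleftrightarrow> y = \<one>"
proof
  assume "conj_elt G y g = \<one>"
  then have "conj_elt G (conj_elt G y g) (inv g) = \<one>" using assms by simp
  then show "y = \<one>" using assms by (simp add: conj_elt_conj_elt)
qed (use assms in simp)

lemma ord_conj_elt:
  assumes "y \<in> carrier G" "g \<in> carrier G"
  shows "ord (conj_elt G y g) = ord y"
proof -
  have "conj_elt G y g [^] (i::nat) = conj_elt G (y [^] i) g" for i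
    by (induction i) (use assms in \<open>simp_all add: conj_elt_mult\<close>)
  then show ?thesis using assms by (simp add: ord_def conj_elt_eq_one_iff)
qed

lemma inj_on_conj_elt: "g \<in> carrier G \<Longrightarrow> inj_on (\<lambda>y. conj_elt G y g) (carrier G)"
  by (rule inj_on_inverseI[where g = "\<lambda>y. conj_elt G y (inv g)"]) (simp add: conj_elt_conj_elt)

lemma card_conj_set: "Q \<subseteq> carrier G \<Longrightarrow> g \<in> carrier G \<Longrightarrow> card (conj_set G Q g) = card Q"
  unfolding conj_set_def by (rule card_image) (rule inj_on_subset[OF inj_on_conj_elt])

lemma conj_set_conj_set:
  "Q \<subseteq> carrier G \<Longrightarrow> g \<in> carrier G \<Longrightarrow> h \<in> carrier G \<Longrightarrow>
    conj_set G (conj_set G Q g) h = conj_set G Q (g \<otimes> h)"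
  unfolding conj_set_def image_image by (rule image_cong) (auto simp: conj_elt_conj_elt)

lemma conj_set_one: "Q \<subseteq> carrier G \<Longrightarrow> conj_set G Q \<one> = Q"
  by (force simp: conj_set_def)

lemma conj_elt_in_conj_set: "y \<in> Q \<Longrightarrow> conj_elt G y g \<in> conj_set G Q g"
  by (simp add: conj_set_def)

lemma conj_elt_in_conj_set_iff:
  assumes "Q \<subseteq> carrier G" "y \<in> carrier G" "g \<in> carrier G"
  shows "conj_elt G y g \<in> conj_set G Q g \<longleftrightarrow> y \<in> Q"
  using assms inj_on_image_mem_iff[OF inj_on_conj_elt] by (simp add: conj_set_def)

lemma subgroup_conj_set:
  assumes "subgroup Q G" "g \<in> carrier G"
  shows "subgroup (conj_set G Q g) G"
  using subgroup_conjugation_is_surj1[OF assms(2,1)] by (simp add: conj_set_eq)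

text \<open>\<open>normalizer\<close> is the stabilizer under Q -> g Q g^{-1}, whereas
  \<open>conj_set\<close> is g^{-1} Q g; an element fixes Q under one of them iff it does under the
  other.\<close>

lemma mem_normalizer_iff:
  assumes "Q \<subseteq> carrier G"
  shows "g \<in> normalizer G Q \<longleftrightarrow> g \<in> carrier G \<and> conj_set G Q g = Q"
proof -
  have "g <# Q #> inv g = Q \<longleftrightarrow> conj_set G Q g = Q" if g: "g \<in> carrier G"
  proof -
    have "g <# Q #> inv g = conj_set G Q (inv g)" using g by (simp add: conj_set_eq)
    also have "\<dots> = Q \<longleftrightarrow> conj_set G Q g = Q"
      using conj_set_conj_set[OF assms, of g "inv g"] conj_set_conj_set[OF assms, of "inv g" g]
        conj_set_one[OF assms] g by auto
    finally show ?thesis .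
  qed
  then show ?thesis using assms by (auto simp: normalizer_def stabilizer_def)
qed

lemma normalizer_closed: "Q \<subseteq> carrier G \<Longrightarrow> g \<in> normalizer G Q \<Longrightarrow> g \<in> carrier G"
  by (simp add: mem_normalizer_iff)

lemma conj_elt_normalizer:
  "Q \<subseteq> carrier G \<Longrightarrow> g \<in> normalizer G Q \<Longrightarrow> y \<in> Q \<Longrightarrow> conj_elt G y g \<in> Q"
  by (metis mem_normalizer_iff conj_elt_in_conj_set)

lemma normalizerI:
  assumes "finite Q" "Q \<subseteq> carrier G" "g \<in> carrier G" "\<And>y. y \<in> Q \<Longrightarrow> conj_elt G y g \<in> Q"
  shows "g \<in> normalizer G Q"
proof -
  have "conj_set G Q g \<subseteq> Q" using assms(4) by (auto simp: conj_set_def)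
  then have "conj_set G Q g = Q" using assms by (simp add: card_conj_set card_subset_eq)
  then show ?thesis using assms by (simp add: mem_normalizer_iff)
qed

lemma self_subset_normalizer:
  assumes "finite Q" "subgroup Q G"
  shows "Q \<subseteq> normalizer G Q"
proof
  fix g assume "g \<in> Q"
  then show "g \<in> normalizer G Q"
    using assms by (intro normalizerI) (auto simp: conj_elt_def subgroup_def subset_iff)
qed

lemma conj_elt_in_normalizer:
  assumes "Q \<subseteq> carrier G" "x \<in> normalizer G Q" "g \<in> carrier G"
  shows "conj_elt G x g \<in> normalizer G (conj_set G Q g)"
proof -
  have x: "x \<in> carrier G" "conj_set G Q x = Q" using assms by (simp_all add: mem_normalizer_iff)
  have "conj_set G Q g \<subseteq> carrier G" using assms by (auto simp: conj_set_def)
  moreover have "g \<otimes> conj_elt G x g = x \<otimes> g" 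
    using x assms by (simp add: conj_elt_def m_assoc[symmetric])
  then have "conj_set G (conj_set G Q g) (conj_elt G x g) = conj_set G Q g"
    using assms x by (metis conj_elt_closed conj_set_conj_set)
  ultimately show ?thesis using x assms by (simp add: mem_normalizer_iff)
qed

text \<open>T c u = T c says that c u c^{-1} lies in T. This turns a fixed coset T c into
  conjugation by \<open>inv c\<close> into T.\<close>

lemma mem_if_fixes_rcoset:
  assumes T: "subgroup T G" and c: "c \<in> carrier G" and u: "u \<in> carrier G"
    and eq: "T #> c #> u = T #> c"
  shows "conj_elt G u (inv c) \<in> T"
proof -
  have "T #> (c \<otimes> u) = T #> c"
    using eq coset_mult_assoc[OF subgroup.subset[OF T] c u] by simp
  then have "T #> (c \<otimes> u \<otimes> inv c) = T"
    using coset_mult_inv2[OF _ _ _ subgroup.subset[OF T]] c u by simp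
  then show ?thesis using coset_join1 T c u by (simp add: conj_elt_def)
qed

text \<open>The conjugacy part of Sylow's theorem. The index of T is prime to p while the number of
  non-fixed cosets is divisible by p, so U fixes some coset T c.\<close>

lemma p_subgroup_conj_into:
  assumes fin: "finite (carrier G)" and p: "prime p"
    and T: "subgroup T G" and U: "subgroup U G" "card U = p ^ k"
    and np: "\<not> p dvd card (rcosets T)"
  shows "\<exists>g\<in>carrier G. conj_set G U g \<subseteq> T"
proof -
  have "{C \<in> rcosets T. \<exists>u\<in>U. C #> u \<noteq> C} \<noteq> rcosets T"
    using prime_dvd_card_non_fixed_rcosets[OF fin p T U] np by auto
  then obtain C where "C \<in> rcosets T" "\<forall>u\<in>U. C #> u = C" by blast
  then obtain c where c: "c \<in> carrier G" "\<And>u. u \<in> U \<Longrightarrow> T #> c #> u = T #> c"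
    by (auto simp: RCOSETS_def)
  then have "conj_set G U (inv c) \<subseteq> T"
    using mem_if_fixes_rcoset[OF T] subgroup.subset[OF U(1)] by (auto simp: conj_set_def)
  then show ?thesis using c(1) by blast
qed

text \<open>Let R act on its own cosets. Their number and the number of non-fixed ones are divisible
  by p, hence so is the number of fixed ones. R itself is fixed, so there is a second fixed coset R
  c, and \<open>inv c\<close> normalizes R without lying in it.\<close>

lemma p_group_normalizer_grows:
  assumes fin: "finite (carrier G)" and p: "prime p" and ord: "order G = p ^ a"
    and R: "subgroup R G" "R \<noteq> carrier G"
  shows "\<exists>g\<in>carrier G - R. g \<in> normalizer G R"
proof -
  have lag: "card (rcosets R) * card R = p ^ a" using lagrange[OF R(1)] ord by simp
  obtain k where k: "card R = p ^ k"
    using lag divides_primepow_nat[OF p, of _ a] by (metis dvd_triv_right)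
  let ?F = "{C \<in> rcosets R. \<exists>u\<in>R. C #> u \<noteq> C}"
  have RG: "R \<subseteq> carrier G" using R(1) by (rule subgroup.subset)
  have finr: "finite (rcosets R)" 
    using fin rcosets_subset_PowG[OF R(1)] by (meson finite_Pow_iff finite_subset)
  have "card R < card (carrier G)" using RG R(2) fin by (simp add: psubset_card_mono psubsetI)
  then have "card (rcosets R) \<noteq> 1" using lag ord by (auto simp: order_def)
  then have "p dvd card (rcosets R)"
    using lag prime_dvd_if_dvd_prime_power[OF p, of _ a] by (metis dvd_triv_left)
  moreover have "card (rcosets R) = card ?F + card (rcosets R - ?F)"
    using finr by (subst card_Un_disjoint[symmetric]) (auto intro: arg_cong[where f = card])
  ultimately have "p dvd card (rcosets R - ?F)"
    using prime_dvd_card_non_fixed_rcosets[OF fin p R(1) R(1) k] by (simp add: dvd_add_right_iff)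
  then have "card (rcosets R - ?F) \<noteq> 1" using p not_prime_unit by auto
  moreover have "R \<in> rcosets R - ?F"
    using R(1) RG subgroup.subgroup_in_rcosets[OF R(1) is_group] by (auto simp: coset_join2)
  ultimately have "rcosets R - ?F \<noteq> {R}" "R \<in> rcosets R - ?F" by auto
  then obtain C where C: "C \<in> rcosets R - ?F" "C \<noteq> R" by blast
  then obtain c where c: "c \<in> carrier G" "C = R #> c" by (auto simp: RCOSETS_def)
  have "c \<notin> R" using C c coset_join2[OF c(1) R(1)] by auto
  moreover have "inv c \<in> normalizer G R"
    using C c mem_if_fixes_rcoset[OF R(1) c(1)] RG fin finite_subset
    by (intro normalizerI) auto
  moreover have "inv c \<notin> R" using \<open>c \<notin> R\<close> c R(1) by (metis inv_inv subgroup.m_inv_closed)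
  ultimately show ?thesis using c by blast
qed

end

section \<open>Fusion in a Sylow subgroup\<close>

locale sylow_pair = group G for G :: "('a, 'b) monoid_scheme" (structure) +
  fixes p :: nat and S :: "'a set"
  assumes finite_carrier: "finite (carrier G)"
    and prime_p: "prime p"
    and p_dvd_order: "p dvd order G"
    and sylow_S: "sylow_subgroup p G S"
begin

abbreviation "N \<equiv> normalizer_group G S"

text \<open>This is O^{p'}(N_G(Q)), given by generators within G, so that inductions over
  \<open>generate\<close> use the operations of G. \<open>O_pprime_normalizer\<close> identifies it
  with \<open>O_pprime\<close>.\<close>

definition Op :: "'a set \<Rightarrow> 'a set" where
  "Op Q = generate G (p_elements p G \<inter> normalizer G Q)"

lemma S_subgroup: "subgroup S G"
  using sylow_S by (simp add: sylow_subgroup_def)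

lemma S_subset: "S \<subseteq> carrier G"
  using S_subgroup by (rule subgroup.subset)

lemma S_closed: "y \<in> S \<Longrightarrow> y \<in> carrier G"
  using S_subset by blast

text \<open>Here the assumption that p divides |G| enters: it provides non-trivial base points in
  S.\<close>

lemma S_nontriv: "S \<noteq> {\<one>}"
proof
  assume "S = {\<one>}"
  then have "multiplicity p (order G) = 0"
    using sylow_S prime_gt_1_nat[OF prime_p] nat_power_eq_Suc_0_iff[of p]
    by (auto simp: sylow_subgroup_def)
  then show False
    using p_dvd_order prime_p finite_carrier order_gt_0_iff_finite
    by (metis multiplicity_eq_zero_iff not_prime_unit not_gr_zero)
qed

lemma nontriv_subgroupsD:
  assumes "Q \<in> nontriv_subgroups G S"
  shows "subgroup Q G" "Q \<subseteq> S" "Q \<subseteq> carrier G" "finite Q" "\<exists>y\<in>Q. y \<noteq> \<one>"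
proof -
  show Q: "subgroup Q G" "Q \<subseteq> S" "Q \<subseteq> carrier G"
    using assms subgroup.subset by (auto simp: nontriv_subgroups_def)
  then show "finite Q" using finite_carrier finite_subset by blast
  show "\<exists>y\<in>Q. y \<noteq> \<one>"
    using assms subgroup.one_closed[OF Q(1)] by (auto simp: nontriv_subgroups_def)
qed

lemma S_in_nontriv_subgroups: "S \<in> nontriv_subgroups G S"
  using S_subgroup S_nontriv by (simp add: nontriv_subgroups_def)

lemma normalizer_subgroup: "Q \<subseteq> carrier G \<Longrightarrow> subgroup (normalizer G Q) G"
  by (rule normalizer_imp_subgroup)

lemma group_N: "group N"
  using subgroup_imp_group[OF normalizer_subgroup[OF S_subset]] .

section \<open>The subgroups O^{p'}(N_G(Q))\<close>

lemma p_elements_normalizer: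
  assumes "Q \<subseteq> carrier G"
  shows "p_elements p (normalizer_group G Q) = p_elements p G \<inter> normalizer G Q"
proof -
  interpret NQ: group "normalizer_group G Q"
    using subgroup_imp_group[OF normalizer_subgroup[OF assms]] .
  have "NQ.ord x = ord x" if "x \<in> normalizer G Q" for x
    using that normalizer_closed[OF assms] by (simp add: NQ.ord_def ord_def nat_pow_def)
  then show ?thesis using normalizer_closed[OF assms] by (auto simp: p_elements_def)
qed

lemma Op_eq_generate_normalizer:
  "Q \<subseteq> carrier G \<Longrightarrow>
    Op Q = generate (normalizer_group G Q) (p_elements p (normalizer_group G Q))"
  by (simp add: Op_def p_elements_normalizer generate_consistent normalizer_subgroup)

lemma O_pprime_normalizer:
  assumes "Q \<subseteq> carrier G"
  shows "O_pprime p (normalizer_group G Q) = Op Q"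
proof -
  have "finite (normalizer G Q)"
    using subgroup.subset[OF normalizer_subgroup[OF assms]] finite_carrier finite_subset by blast
  then show ?thesis
    using O_pprime_eq_generate[OF subgroup_imp_group[OF normalizer_subgroup[OF assms]] _ prime_p]
      Op_eq_generate_normalizer[OF assms] by simp
qed

lemma Op_subgroup: "Q \<subseteq> carrier G \<Longrightarrow> subgroup (Op Q) G"
  unfolding Op_def by (rule generate_is_subgroup) (auto simp: p_elements_def)

lemma Op_subset_normalizer: "Q \<subseteq> carrier G \<Longrightarrow> Op Q \<subseteq> normalizer G Q"
  unfolding Op_def by (rule generate_subgroup_incl[OF _ normalizer_subgroup]) auto

lemma Op_closed: "Q \<subseteq> carrier G \<Longrightarrow> x \<in> Op Q \<Longrightarrow> x \<in> carrier G"
  using Op_subset_normalizer normalizer_closed by blast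

text \<open>Conjugation by g preserves orders and takes N_G(Q) to N_G(Q^g), so it maps generators to
  generators.\<close>

lemma Op_conj_elt:
  assumes "Q \<subseteq> carrier G" "x \<in> Op Q" "g \<in> carrier G"
  shows "conj_elt G x g \<in> Op (conj_set G Q g)"
  using assms(2) unfolding Op_def
proof (induction rule: generate.induct)
  case one
  then show ?case using assms(3) by (simp add: generate.one)
next
  case (incl h)
  then show ?case
    using assms by (intro generate.incl) (auto simp: p_elements_def ord_conj_elt conj_elt_in_normalizer)
next
  case (inv h)
  then have "inv (conj_elt G h g) \<in> generate G (p_elements p G \<inter> normalizer G (conj_set G Q g))"
    using assms by (intro generate.inv) (auto simp: p_elements_def ord_conj_elt conj_elt_in_normalizer)
  then show ?case using inv assms(3) by (simp add: conj_elt_inv p_elements_def)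
next
  case (eng h1 h2)
  have "h1 \<in> carrier G" "h2 \<in> carrier G"
    using eng.hyps assms(1) Op_closed by (auto simp: Op_def)
  then show ?case using eng.IH assms(3) by (simp add: conj_elt_mult generate.eng)
qed

section \<open>Sylow theory inside S and inside \<open>Op Q\<close>\<close>

lemma ord_dvd_card_subgroup:
  assumes "subgroup U G" "x \<in> U"
  shows "ord x dvd card U"
proof -
  interpret U: group "G\<lparr>carrier := U\<rparr>" using assms(1) by (rule subgroup_imp_group)
  have "x [^]\<^bsub>G\<lparr>carrier := U\<rparr>\<^esub> order (G\<lparr>carrier := U\<rparr>) = \<one>\<^bsub>G\<lparr>carrier := U\<rparr>\<^esub>"
    using assms(2) by (intro U.pow_order_eq_1) simp
  then have "x [^] card U = \<one>" by (simp add: order_def nat_pow_def)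
  then show ?thesis using pow_eq_id subgroup.mem_carrier[OF assms] by blast
qed

lemma p_subgroup_subset_p_elements:
  assumes "subgroup U G" "card U = p ^ k"
  shows "U \<subseteq> p_elements p G"
proof
  fix x assume x: "x \<in> U"
  have "ord x dvd p ^ k" using ord_dvd_card_subgroup[OF assms(1) x] assms(2) by simp
  then show "x \<in> p_elements p G"
    using subgroup.mem_carrier[OF assms(1) x] prime_p
    by (auto simp: p_elements_def divides_primepow_nat)
qed

lemma p_subgroup_subset_Op:
  "subgroup U G \<Longrightarrow> card U = p ^ k \<Longrightarrow> U \<subseteq> normalizer G Q \<Longrightarrow> U \<subseteq> Op Q"
  unfolding Op_def using p_subgroup_subset_p_elements[of U k] by (auto intro: generate.incl)

lemma card_subgroup_dvd:
  assumes "subgroup U G" "subgroup V G" "U \<subseteq> V"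
  shows "card U dvd card V"
proof -
  have "card (rcosets\<^bsub>G\<lparr>carrier := V\<rparr>\<^esub> U) * card U = card V"
    using group.lagrange[OF subgroup_imp_group[OF assms(2)] subgroup_incl[OF assms]]
    by (simp add: order_def)
  then show ?thesis by (metis dvd_triv_right)
qed

lemma card_subgroup_S:
  assumes "subgroup U G" "U \<subseteq> S"
  obtains k where "card U = p ^ k"
  using card_subgroup_dvd[OF assms(1) S_subgroup assms(2)] sylow_S prime_p
  by (auto simp: sylow_subgroup_def divides_primepow_nat)

lemma prime_not_dvd_index:
  assumes "group H" "finite (carrier H)" "subgroup T H" "card T = p ^ multiplicity p (order H)"
  shows "\<not> p dvd card (rcosets\<^bsub>H\<^esub> T)"
proof
  let ?a = "multiplicity p (order H)"
  assume "p dvd card (rcosets\<^bsub>H\<^esub> T)"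
  then have "p * p ^ ?a dvd card (rcosets\<^bsub>H\<^esub> T) * card T"
    using assms(4) by (simp add: mult_dvd_mono)
  then have "p ^ Suc ?a dvd order H"
    using group.lagrange[OF assms(1,3)] by simp
  moreover have "order H \<noteq> 0"
    using assms(1,2) monoid.order_gt_0_iff_finite[OF group.is_monoid[OF assms(1)]] by simp
  ultimately show False
    using prime_p not_prime_unit multiplicity_geI[of "order H" p "Suc ?a"] by auto
qed

lemma p_subgroup_conj_into_S:
  assumes "subgroup U G" "card U = p ^ k"
  shows "\<exists>g\<in>carrier G. conj_set G U g \<subseteq> S"
  using p_subgroup_conj_into[OF finite_carrier prime_p S_subgroup assms] sylow_S
    prime_not_dvd_index[OF is_group finite_carrier] by (simp add: sylow_subgroup_def)

text \<open>T is a Sylow p-subgroup of \<open>Op Q\<close>. Every p-subgroup of N_G(Q) consists of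
  p-elements and so lies in \<open>Op Q\<close>; therefore the conjugating element can be found in
  \<open>Op Q\<close> rather than merely in N_G(Q).\<close>

lemma Op_sylow:
  assumes Q: "Q \<subseteq> carrier G"
  obtains T k where "subgroup T G" "card T = p ^ k"
    "\<And>U j. subgroup U G \<Longrightarrow> U \<subseteq> normalizer G Q \<Longrightarrow> card U = p ^ j \<Longrightarrow>
      \<exists>c\<in>Op Q. conj_set G U c \<subseteq> T"
proof -
  let ?H = "G\<lparr>carrier := Op Q\<rparr>"
  interpret H: group ?H using subgroup_imp_group[OF Op_subgroup[OF Q]] .
  have fin: "finite (carrier ?H)"
    using subgroup.subset[OF Op_subgroup[OF Q]] finite_carrier finite_subset by auto
  obtain m where "order ?H = p ^ multiplicity p (order ?H) * m" using multiplicity_dvd by (metis dvdE)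
  then obtain T where T: "subgroup T ?H" "card T = p ^ multiplicity p (order ?H)"
    using sylow_thm[OF prime_p H.is_group _ fin] by blast
  have "\<exists>c\<in>Op Q. conj_set G U c \<subseteq> T"
    if U: "subgroup U G" "U \<subseteq> normalizer G Q" "card U = p ^ j" for U j
  proof -
    have "subgroup U ?H"
      using U(1) Op_subgroup[OF Q] p_subgroup_subset_Op[OF U(1,3,2)] by (rule subgroup_incl)
    then obtain c where c: "c \<in> Op Q" "conj_set ?H U c \<subseteq> T"
      using H.p_subgroup_conj_into[OF fin prime_p T(1) _ U(3)]
        prime_not_dvd_index[OF H.is_group fin T] by auto
    have "conj_set ?H U c = conj_set G U c"
      using c(1) Op_subgroup[OF Q] by (simp add: conj_set_def conj_elt_def)
    then show ?thesis using c by auto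
  qed
  moreover have "subgroup T G" using T(1) Op_subgroup[OF Q] incl_subgroup by blast
  ultimately show thesis using that T(2) by blast
qed

text \<open>The growth of normalizers is applied to S as a group of its own and carried back to G.
  It makes the induction measure in \<open>alperin_fusion\<close> decrease.\<close>

lemma normalizer_grows_in_S:
  assumes R: "subgroup R G" "R \<subseteq> S" "R \<noteq> S"
  shows "card R < card (normalizer G R \<inter> S)"
proof -
  let ?H = "G\<lparr>carrier := S\<rparr>"
  interpret H: group ?H using subgroup_imp_group[OF S_subgroup] .
  have fS: "finite S" using S_subset finite_carrier finite_subset by blast
  have "subgroup R ?H" using R(1) S_subgroup R(2) by (rule subgroup_incl)
  moreover have "order ?H = p ^ multiplicity p (order G)"
    using sylow_S by (simp add: order_def sylow_subgroup_def)
  ultimately obtain g where g: "g \<in> S - R" "g \<in> normalizer ?H R"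
    using H.p_group_normalizer_grows[of p _ R] fS prime_p R(3) by auto
  have RG: "R \<subseteq> carrier G" using R(1) by (rule subgroup.subset)
  have "conj_set ?H R g = R" using g(2) H.mem_normalizer_iff R(2) by simp
  moreover have "conj_set ?H R g = conj_set G R g"
    using g(1) S_subgroup by (simp add: conj_set_def conj_elt_def)
  ultimately have "g \<in> normalizer G R" using g(1) RG S_closed by (simp add: mem_normalizer_iff)
  moreover have "R \<subseteq> normalizer G R"
    using R fS finite_subset by (intro self_subset_normalizer) auto
  ultimately have "R \<subset> normalizer G R \<inter> S" using g(1) R(2) by blast
  then show ?thesis using fS by (simp add: psubset_card_mono)
qed

section \<open>Chains of elements of the subgroups \<open>Op Q\<close>\<close>

text \<open>
  The factorizations in the definition of \<open>K\<^sub>G\<close>, for a base point \<open>y \<in> S\<close> (possibly trivial).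
\<close>

inductive chain :: "'a \<Rightarrow> 'a \<Rightarrow> bool" where
  chain_one: "y \<in> S \<Longrightarrow> chain y \<one>"
| chain_step: "chain y w \<Longrightarrow> Q \<in> nontriv_subgroups G S \<Longrightarrow> conj_elt G y w \<in> Q \<Longrightarrow> x \<in> Op Q \<Longrightarrow>
    chain y (w \<otimes> x)"

lemma chainD:
  assumes "chain y w"
  shows "y \<in> S" "w \<in> carrier G" "conj_elt G y w \<in> S"
proof -
  have "y \<in> S \<and> w \<in> carrier G \<and> conj_elt G y w \<in> S"
    using assms
  proof induction
    case (chain_one y)
    then show ?case using S_closed by simp
  next
    case (chain_step y w Q x)
    note Q = nontriv_subgroupsD[OF chain_step.hyps(2)]
    have x: "x \<in> normalizer G Q" "x \<in> carrier G"
      using Op_subset_normalizer[OF Q(3)] Op_closed[OF Q(3)] chain_step.hyps(4) by auto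
    have "conj_elt G (conj_elt G y w) x \<in> Q"
      using conj_elt_normalizer[OF Q(3) x(1)] chain_step.hyps(3) .
    then show ?case using chain_step.IH x Q(2) S_closed by (auto simp: conj_elt_conj_elt)
  qed
  then show "y \<in> S" "w \<in> carrier G" "conj_elt G y w \<in> S" by auto
qed

lemma chain_single:
  assumes "Q \<in> nontriv_subgroups G S" "y \<in> Q" "x \<in> Op Q"
  shows "chain y x"
proof -
  note Q = nontriv_subgroupsD[OF assms(1)]
  have "chain y (\<one> \<otimes> x)"
    by (rule chain_step[OF chain_one assms(1) _ assms(3)]) (use Q assms S_closed in auto)
  then show ?thesis using Op_closed[OF Q(3) assms(3)] by simp
qed

lemma chain_trans:
  assumes "chain y w" "chain (conj_elt G y w) w'"
  shows "chain y (w \<otimes> w')"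
proof -
  note w = chainD[OF assms(1)]
  \<comment> \<open>The base point of the second chain becomes a variable tied by an equation, so
    that the induction can run over that chain alone.\<close>
  have "chain y (w \<otimes> w')" if "chain z w'" "z = conj_elt G y w" for z
    using that
  proof (induction)
    case (chain_one z)
    then show ?case using assms(1) w by simp
  next
    case (chain_step z w' Q x)
    note w' = chainD[OF chain_step.hyps(1)]
    have x: "x \<in> carrier G"
      using chain_step.hyps(2,4) Op_closed nontriv_subgroupsD(3) by blast
    have "chain y (w \<otimes> w' \<otimes> x)"
      using chain.chain_step[OF chain_step.IH[OF chain_step.prems] chain_step.hyps(2) _ chain_step.hyps(4)]
        chain_step.hyps(3) chain_step.prems w w' S_closed by (simp add: conj_elt_conj_elt)
    then show ?case using w w' x by (simp add: m_assoc)
  qed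
  then show ?thesis using assms(2) by blast
qed

text \<open>The chain is read backwards. A factor x in \<open>Op Q\<close> is undone by
  \<open>inv x\<close>, and since x normalizes Q, the conjugate of the base point after x is still
  in Q.\<close>

lemma chain_inv:
  assumes "chain y w"
  shows "chain (conj_elt G y w) (inv w)"
  using assms
proof induction
  case (chain_one y)
  then show ?case using S_closed by (simp add: chain.chain_one)
next
  case (chain_step y w Q x)
  note Q = nontriv_subgroupsD[OF chain_step.hyps(2)]
  have x: "x \<in> normalizer G Q" "x \<in> carrier G"
    using Op_subset_normalizer[OF Q(3)] Op_closed[OF Q(3)] chain_step.hyps(4) by auto
  note w = chainD[OF chain_step.hyps(1)]
  have y: "y \<in> carrier G" using w(1) S_closed by blast
  have "conj_elt G y (w \<otimes> x) \<in> Q"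
    using conj_elt_normalizer[OF Q(3) x(1) chain_step.hyps(3)] w x y by (simp add: conj_elt_conj_elt)
  moreover have "inv x \<in> Op Q"
    using chain_step.hyps(4) Op_subgroup[OF Q(3)] by (simp add: subgroup.m_inv_closed)
  ultimately have "chain (conj_elt G y (w \<otimes> x)) (inv x)"
    using chain_single chain_step.hyps(2) by blast
  moreover have "conj_elt G (conj_elt G y (w \<otimes> x)) (inv x) = conj_elt G y w"
    using w x y by (simp add: conj_elt_conj_elt m_assoc)
  ultimately have "chain (conj_elt G y (w \<otimes> x)) (inv x \<otimes> inv w)"
    using chain_trans chain_step.IH by metis
  then show ?case using w x by (simp add: inv_mult_group)
qed

lemma normalizer_S_D:
  assumes "h \<in> normalizer G S"
  shows "h \<in> carrier G" "conj_set G S h = S" "y \<in> S \<Longrightarrow> conj_elt G y h \<in> S"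
  using assms S_subset mem_normalizer_iff conj_elt_normalizer by auto

lemma conj_set_nontriv_subgroups:
  assumes "Q \<in> nontriv_subgroups G S" "h \<in> carrier G" "conj_set G Q h \<subseteq> S"
  shows "conj_set G Q h \<in> nontriv_subgroups G S"
proof -
  note Q = nontriv_subgroupsD[OF assms(1)]
  obtain y where y: "y \<in> Q" "y \<noteq> \<one>" using Q(5) by blast
  have "conj_elt G y h \<in> conj_set G Q h" "conj_elt G y h \<noteq> \<one>"
    using y Q(3) assms(2) by (auto simp: conj_set_def conj_elt_eq_one_iff subset_iff)
  then show ?thesis
    using subgroup_conj_set[OF Q(1) assms(2)] assms(3) by (auto simp: nontriv_subgroups_def)
qed

text \<open>Elements of N_G(S) permute the subgroups of S, so they carry a chain along factor by
  factor, replacing Q by Q^h. This is what lets h move past a chain in products.\<close>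

lemma chain_conj:
  assumes "chain y w" "h \<in> normalizer G S"
  shows "chain (conj_elt G y h) (conj_elt G w h)"
  using assms(1)
proof induction
  case (chain_one y)
  then show ?case using normalizer_S_D[OF assms(2)] by (simp add: chain.chain_one)
next
  case (chain_step y w Q x)
  note Q = nontriv_subgroupsD[OF chain_step.hyps(2)]
  note h = normalizer_S_D[OF assms(2)]
  have x: "x \<in> carrier G" using Op_closed[OF Q(3) chain_step.hyps(4)] .
  note w = chainD[OF chain_step.hyps(1)]
  have y: "y \<in> carrier G" using w(1) S_closed by blast
  have "conj_set G Q h \<subseteq> S" using Q(2) h(2) by (auto simp: conj_set_def)
  then have Q': "conj_set G Q h \<in> nontriv_subgroups G S"
    using conj_set_nontriv_subgroups chain_step.hyps(2) h(1) by blast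
  have "conj_elt G (conj_elt G y h) (conj_elt G w h) = conj_elt G (conj_elt G y w) h"
    using y w h by (simp add: conj_elt_def m_assoc inv_mult_group mult_inv_cancel)
  then have "conj_elt G (conj_elt G y h) (conj_elt G w h) \<in> conj_set G Q h"
    using chain_step.hyps(3) by (simp add: conj_elt_in_conj_set)
  then have "chain (conj_elt G y h) (conj_elt G w h \<otimes> conj_elt G x h)"
    using chain.chain_step[OF chain_step.IH Q'] Op_conj_elt[OF Q(3) chain_step.hyps(4) h(1)] by blast
  then show ?case using w x h by (simp add: conj_elt_mult)
qed

text \<open>The decomposition x = w h into a chain w based at \<open>y\<close> and an element h of
  N_G(S), with w eliminated as x h^{-1}.\<close>

definition factors :: "'a \<Rightarrow> 'a \<Rightarrow> 'a \<Rightarrow> bool" where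
  "factors y x h \<longleftrightarrow> x \<in> carrier G \<and> h \<in> normalizer G S \<and> chain y (x \<otimes> inv h)"

lemma normalizer_S_closed:
  assumes "h \<in> normalizer G S"
  shows "inv h \<in> normalizer G S" "k \<in> normalizer G S \<Longrightarrow> h \<otimes> k \<in> normalizer G S"
  using assms subgroup.m_inv_closed[OF normalizer_subgroup[OF S_subset]]
    subgroup.m_closed[OF normalizer_subgroup[OF S_subset]] by auto

lemma one_in_normalizer_S: "\<one> \<in> normalizer G S"
  using subgroup.one_closed[OF normalizer_subgroup[OF S_subset]] .

lemma factorsD:
  assumes "factors y x h"
  shows "x \<in> carrier G" "h \<in> normalizer G S" "y \<in> S" "conj_elt G y x \<in> S"
proof -
  show xh: "x \<in> carrier G" "h \<in> normalizer G S" "y \<in> S"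
    using assms chainD by (auto simp: factors_def)
  have "conj_elt G (conj_elt G y (x \<otimes> inv h)) h \<in> S"
    using assms chainD normalizer_S_D xh by (auto simp: factors_def)
  then show "conj_elt G y x \<in> S"
    using xh S_closed normalizer_S_D(1) by (simp add: conj_elt_conj_elt m_assoc)
qed

lemma factors_normalizer: "y \<in> S \<Longrightarrow> h \<in> normalizer G S \<Longrightarrow> factors y h h"
  using normalizer_S_D(1) by (simp add: factors_def chain_one)

lemma factors_Op:
  assumes "Q \<in> nontriv_subgroups G S" "y \<in> Q" "x \<in> Op Q"
  shows "factors y x \<one>"
  using chain_single[OF assms] Op_closed[OF nontriv_subgroupsD(3)[OF assms(1)] assms(3)]
    one_in_normalizer_S by (simp add: factors_def)

text \<open>If x = w h and x' = w' h', then x x' = w (h w' h^{-1}) (h h'). By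
  \<open>chain_conj\<close> the middle factor is a chain, and it starts at the conjugate of y by w,
  where w ends.\<close>

lemma factors_mult:
  assumes "factors y x h" "factors (conj_elt G y x) x' h'"
  shows "factors y (x \<otimes> x') (h \<otimes> h')"
proof -
  note x = factorsD[OF assms(1)] and x' = factorsD[OF assms(2)]
  have c: "h \<in> carrier G" "h' \<in> carrier G" "y \<in> carrier G" "inv h \<in> normalizer G S"
    using x x' normalizer_S_D(1) S_closed normalizer_S_closed by auto
  have "chain (conj_elt G (conj_elt G y x) (inv h)) (conj_elt G (x' \<otimes> inv h') (inv h))"
    using assms(2) c chain_conj by (simp add: factors_def)
  then have "chain y ((x \<otimes> inv h) \<otimes> conj_elt G (x' \<otimes> inv h') (inv h))"
    using assms(1) c x chain_trans[of y "x \<otimes> inv h"] by (simp add: factors_def conj_elt_conj_elt)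
  also have "(x \<otimes> inv h) \<otimes> conj_elt G (x' \<otimes> inv h') (inv h) = x \<otimes> x' \<otimes> inv (h \<otimes> h')"
    using x x' c by (simp add: conj_elt_def m_assoc inv_mult_group inv_mult_cancel)
  finally show ?thesis using x x' normalizer_S_closed by (simp add: factors_def)
qed

text \<open>From x = w h comes x^{-1} = (h^{-1} w^{-1} h) h^{-1}, so \<open>chain_inv\<close>
  followed by \<open>chain_conj\<close> applies.\<close>

lemma factors_inv:
  assumes "factors y x h"
  shows "factors (conj_elt G y x) (inv x) (inv h)"
proof -
  note x = factorsD[OF assms]
  have c: "h \<in> carrier G" "y \<in> carrier G" using x normalizer_S_D(1) S_closed by auto
  have "chain (conj_elt G y (x \<otimes> inv h)) (inv (x \<otimes> inv h))"
    using assms by (simp add: factors_def chain_inv)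
  then have "chain (conj_elt G (conj_elt G y (x \<otimes> inv h)) h) (conj_elt G (inv (x \<otimes> inv h)) h)"
    using x(2) chain_conj by blast
  then have "chain (conj_elt G y x) (inv x \<otimes> h)"
    using x c by (simp add: conj_elt_conj_elt conj_elt_def m_assoc inv_mult_group inv_mult_cancel)
  then show ?thesis using x c normalizer_S_closed by (simp add: factors_def)
qed

text \<open>
  Let \<open>R \<noteq> S\<close> and let \<open>T\<close> be a Sylow p-subgroup of \<open>O\<^sup>p\<^sup>'(N\<^sub>G(R\<^sup>x))\<close> with \<open>T\<^sup>g \<le> S\<close>. It contains a
  conjugate \<open>N\<^sub>S(R\<^sup>x)\<^sup>a\<close> and a conjugate \<open>N\<^sub>S(R)\<^sup>x\<^sup>b\<close>, with \<open>a\<close> and \<open>b\<close> in \<open>O\<^sup>p\<^sup>'(N\<^sub>G(R\<^sup>x))\<close>. As normalizers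
  grow in \<open>S\<close>, the induction hypothesis factors \<open>x b g\<close> and \<open>a g\<close>, and \<open>x = (x b g) (a g)\<^sup>-\<^sup>1 (a b\<^sup>-\<^sup>1)\<close>.
\<close>

theorem alperin_fusion:
  assumes "R \<in> nontriv_subgroups G S" "x \<in> carrier G" "conj_set G R x \<subseteq> S"
  shows "\<exists>h. \<forall>y\<in>R. factors y x h"
  using assms
\<comment> \<open>The induction goes from large R to small R and starts at R = S.\<close>
proof (induction "card S - card R" arbitrary: R x rule: less_induct)
  case less
  note R = nontriv_subgroupsD[OF less.prems(1)] and x = less.prems(2)
  have fS: "finite S" using S_subset finite_carrier finite_subset by blast
  show ?case
  proof (cases "R = S")
    \<comment> \<open>Here x normalizes S, so h = x works, with the trivial chain at every base
      point.\<close>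
    case True
    then have "x \<in> normalizer G S"
      using less.prems fS S_subset by (intro normalizerI) (auto simp: conj_set_def)
    then show ?thesis using factors_normalizer R(2) by blast
  next
    case False
    let ?R' = "conj_set G R x"
    let ?M = "normalizer G R \<inter> S" and ?M' = "normalizer G ?R' \<inter> S"
    have R'_nt: "?R' \<in> nontriv_subgroups G S"
      using conj_set_nontriv_subgroups less.prems by blast
    note R' = nontriv_subgroupsD[OF R'_nt]
    have cardR': "card ?R' = card R" using R(3) x by (rule card_conj_set)
    have "?R' \<noteq> S" using False R(2) fS cardR' card_subset_eq by metis
    then have lt: "card R < card ?M" "card R < card ?M'"
      using normalizer_grows_in_S R R' False cardR' by (metis, metis)
    have sub: "subgroup ?M G" "subgroup ?M' G"
      using normalizer_subgroup R(3) R'(3) S_subgroup subgroups_Inter_pair by (blast, blast)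
    have "R \<subseteq> ?M" "?R' \<subseteq> ?M'"
      using self_subset_normalizer R R' by (auto simp: subset_iff)
    then have M_nt: "?M \<in> nontriv_subgroups G S" "?M' \<in> nontriv_subgroups G S"
      using sub R(5) R'(5) by (auto simp: nontriv_subgroups_def)
    have "card ?M \<le> card S" "card ?M' \<le> card S" using fS by (auto intro: card_mono)
    then have meas: "card S - card ?M < card S - card R" "card S - card ?M' < card S - card R"
      using lt by auto
    obtain T k where T: "subgroup T G" "card T = p ^ k"
      and into_T: "\<And>U j. subgroup U G \<Longrightarrow> U \<subseteq> normalizer G ?R' \<Longrightarrow> card U = p ^ j \<Longrightarrow>
          \<exists>c\<in>Op ?R'. conj_set G U c \<subseteq> T"
      using Op_sylow[OF R'(3)] by metis
    obtain g where g: "g \<in> carrier G" "conj_set G T g \<subseteq> S"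
      using p_subgroup_conj_into_S[OF T] by blast
    obtain j where "card ?M' = p ^ j" using card_subgroup_S[OF sub(2)] by auto
    then obtain a where a: "a \<in> Op ?R'" "conj_set G ?M' a \<subseteq> T"
      using into_T[OF sub(2)] by auto
    have MG: "?M \<subseteq> carrier G" "?M' \<subseteq> carrier G" using S_subset by auto
    obtain j where "card ?M = p ^ j" using card_subgroup_S[OF sub(1)] by auto
    then have "card (conj_set G ?M x) = p ^ j" using MG x by (simp add: card_conj_set)
    moreover have "conj_set G ?M x \<subseteq> normalizer G ?R'"
      using conj_elt_in_normalizer[OF R(3) _ x] by (auto simp: conj_set_def)
    ultimately obtain b where b: "b \<in> Op ?R'" "conj_set G (conj_set G ?M x) b \<subseteq> T"
      using into_T[OF subgroup_conj_set[OF sub(1) x]] by blast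
    have ab: "a \<in> carrier G" "b \<in> carrier G" using a b Op_closed[OF R'(3)] by auto
    have mono: "conj_set G A u \<subseteq> conj_set G B u" if "A \<subseteq> B" for A B u
      using that by (auto simp: conj_set_def)
    have "conj_set G ?M (x \<otimes> b \<otimes> g) \<subseteq> S"
      using mono[OF b(2), of g] g MG x ab
      by (simp add: conj_set_conj_set m_assoc subgroup.subset[OF subgroup_conj_set[OF sub(1)]])
    then obtain h1 where h1: "\<And>y. y \<in> ?M \<Longrightarrow> factors y (x \<otimes> b \<otimes> g) h1"
      using less.hyps[OF meas(1) M_nt(1), of "x \<otimes> b \<otimes> g"] x ab g by auto
    have "conj_set G ?M' (a \<otimes> g) \<subseteq> S"
      using mono[OF a(2), of g] g MG ab by (simp add: conj_set_conj_set)
    then obtain h2 where h2: "\<And>y. y \<in> ?M' \<Longrightarrow> factors y (a \<otimes> g) h2"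
      using less.hyps[OF meas(2) M_nt(2), of "a \<otimes> g"] ab g by auto
    \<comment> \<open>\<open>h1\<close> and \<open>h2\<close> were obtained before y, so one h
      serves all of R. The final 1 is contributed by the factor a b^{-1}, which lies in
      \<open>Op\<close> of R^x.\<close>
    have "factors y x (h1 \<otimes> inv h2 \<otimes> \<one>)" if y: "y \<in> R" for y
    proof -
      have yG: "y \<in> carrier G" using y R(3) by blast
      have inv_a: "inv a \<in> Op ?R'" and inv_b: "inv b \<in> Op ?R'"
        using a b Op_subgroup[OF R'(3)] by (simp_all add: subgroup.m_inv_closed)
      \<comment> \<open>The position of y after the factors x b g and (a g)^{-1}. It lies in R^x
        because b and a^{-1} normalize R^x; hence \<open>h2\<close> applies at r, and a b^{-1} can
        be applied there as a single chain step.\<close>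
      define r where "r = conj_elt G y (x \<otimes> b \<otimes> inv a)"
      have "conj_elt G (conj_elt G (conj_elt G y x) b) (inv a) \<in> ?R'"
        using conj_elt_normalizer[OF R'(3)] conj_elt_in_conj_set[OF y] b(1) inv_a
          Op_subset_normalizer[OF R'(3)] by blast
      then have r: "r \<in> ?R'" using yG x ab by (simp add: r_def conj_elt_conj_elt m_assoc)
      have 1: "factors y (x \<otimes> b \<otimes> g) h1" using h1 y \<open>R \<subseteq> ?M\<close> by blast
      have "factors r (a \<otimes> g) h2" using h2 r \<open>?R' \<subseteq> ?M'\<close> by blast
      from factors_inv[OF this]
      have "factors (conj_elt G y (x \<otimes> b \<otimes> g)) (inv (a \<otimes> g)) (inv h2)"
        using yG x ab g by (simp add: r_def conj_elt_conj_elt m_assoc inv_mult_cancel)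
      from factors_mult[OF 1 this]
      have 2: "factors y (x \<otimes> b \<otimes> inv a) (h1 \<otimes> inv h2)"
        using x ab g by (simp add: m_assoc inv_mult_group mult_inv_cancel)
      have "a \<otimes> inv b \<in> Op ?R'"
        using a inv_b Op_subgroup[OF R'(3)] by (simp add: subgroup.m_closed)
      then have "factors r (a \<otimes> inv b) \<one>" using factors_Op[OF R'_nt r] by blast
      from factors_mult[OF 2 this[unfolded r_def]]
      show ?thesis using x ab by (simp add: m_assoc inv_mult_cancel)
    qed
    then show ?thesis by blast
  qed
qed

section \<open>Weak homomorphisms\<close>

text \<open>\<open>partial_prod\<close> is a right fold, so splitting off the last factor takes
  associativity, and with it closure of the factors.\<close>

lemma partial_prod_Suc:
  assumes "\<And>i. i \<in> {1..Suc m} \<Longrightarrow> x i \<in> carrier G"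
  shows "partial_prod G x (Suc m) = partial_prod G x m \<otimes> x (Suc m)"
proof -
  have "foldr (\<otimes>) ys z = foldr (\<otimes>) ys \<one> \<otimes> z" if "set ys \<subseteq> carrier G" "z \<in> carrier G" for ys z
    using that
  proof (induction ys)
    case (Cons a ys)
    have "foldr (\<otimes>) ys \<one> \<in> carrier G" using Cons.prems by (induction ys) auto
    then show ?case using Cons by (simp add: m_assoc)
  qed simp
  from this[of "map x [1..<Suc m]" "x (Suc m)"] show ?thesis
    using assms by (auto simp: partial_prod_def image_subset_iff)
qed

lemma partial_prod_cong:
  "(\<And>i. i \<in> {1..m} \<Longrightarrow> x i = x' i) \<Longrightarrow> partial_prod G x m = partial_prod G x' m"
  unfolding partial_prod_def by (rule arg_cong[where f = "\<lambda>l. foldr (\<otimes>) l \<one>"]) auto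

text \<open>The conditions on y concern only the positions 1 to m - 1. If m = 1, a new base point is
  chosen in \<open>Q 1\<close>. If m > 1, the conjugate of y by \<open>x 1\<close> is in
  \<open>Q 1\<close>, which \<open>x 1\<close> normalizes, so y itself is in
  \<open>Q 1\<close>.\<close>

lemma chain_if_K_gens:
  assumes "g \<in> K_gens G p S"
  shows "g \<in> normalizer G S" "\<exists>y. y \<noteq> \<one> \<and> chain y g"
proof -
  show "g \<in> normalizer G S" using assms by (simp add: K_gens_def)
  obtain m x y Q where m: "m \<ge> 1" and x: "\<forall>i\<in>{1..m}. x i \<in> carrier G"
    and y: "y \<in> carrier G" "y \<noteq> \<one>"
    and Q: "\<forall>i\<in>{1..m}. Q i \<in> nontriv_subgroups G S" and g: "g = partial_prod G x m"
    and xO: "\<forall>i\<in>{1..m}. x i \<in> O_pprime p (normalizer_group G (Q i))"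
    and yQ: "\<forall>i\<in>{1..<m}. conj_elt G y (partial_prod G x i) \<in> Q i \<inter> Q (i + 1)"
    using assms unfolding K_gens_def by blast
  have xQ: "x i \<in> Op (Q i)" if "i \<in> {1..m}" for i
    using that xO O_pprime_normalizer[OF nontriv_subgroupsD(3)] Q by auto
  have Q1: "Q 1 \<in> nontriv_subgroups G S" using Q m by simp
  have pp1: "partial_prod G x 1 = x 1" using m x by (simp add: partial_prod_def)
  show "\<exists>y. y \<noteq> \<one> \<and> chain y g"
  proof (cases "m = 1")
    case True
    obtain z where "z \<in> Q 1" "z \<noteq> \<one>" using nontriv_subgroupsD(5)[OF Q1] by blast
    then show ?thesis using chain_single[OF Q1 _ xQ] g pp1 True by auto
  next
    case False
    note Q1' = nontriv_subgroupsD[OF Q1]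
    have x1: "x 1 \<in> normalizer G (Q 1)" "x 1 \<in> carrier G"
      using xQ[of 1] m Op_subset_normalizer[OF Q1'(3)] Op_closed[OF Q1'(3)] by auto
    have "conj_elt G y (x 1) \<in> conj_set G (Q 1) (x 1)"
      using bspec[OF yQ, of 1] False m pp1 x1 Q1'(3) by (simp add: mem_normalizer_iff)
    then have "y \<in> Q 1" using conj_elt_in_conj_set_iff[OF Q1'(3) y(1) x1(2)] by simp
    have "i \<le> m \<Longrightarrow> chain y (partial_prod G x i)" if "i \<ge> 1" for i
      using that
    proof (induction i rule: dec_induct)
      case base
      then show ?case using chain_single[OF Q1 \<open>y \<in> Q 1\<close> xQ] m pp1 by simp
    next
      case (step i)
      have "chain y (partial_prod G x i \<otimes> x (Suc i))"
        using step Q xQ yQ by (intro chain_step[where Q = "Q (Suc i)"]) auto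
      moreover have "partial_prod G x (Suc i) = partial_prod G x i \<otimes> x (Suc i)"
        using step.prems x by (intro partial_prod_Suc) auto
      ultimately show ?case by simp
    qed
    then show ?thesis using m g y(2) by auto
  qed
qed

lemma K_gens_if_chain:
  assumes "chain y g" "y \<noteq> \<one>" "g \<in> normalizer G S"
  shows "g \<in> K_gens G p S"
proof -
  \<comment> \<open>The last condition on \<open>Q m\<close> is not part of \<open>K_gens\<close>; it is what lets the induction append a factor.\<close>
  define witness where "witness y w m x Q \<longleftrightarrow> m \<ge> 1 \<and> (\<forall>i\<in>{1..m}. x i \<in> carrier G) \<and>
       (\<forall>i\<in>{1..m}. Q i \<in> nontriv_subgroups G S) \<and> w = partial_prod G x m \<and>
       (\<forall>i\<in>{1..m}. x i \<in> Op (Q i)) \<and>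
       (\<forall>i\<in>{1..<m}. conj_elt G y (partial_prod G x i) \<in> Q i \<inter> Q (i + 1)) \<and>
       conj_elt G y (partial_prod G x m) \<in> Q m"
    for y w and m :: nat and x :: "nat \<Rightarrow> 'a" and Q
  have "\<exists>m x Q. witness y g m x Q" using assms(1)
  proof induction
    case (chain_one y)
    \<comment> \<open>As m must be at least 1, the trivial chain becomes a single factor 1 taken in
      \<open>Op S\<close>.\<close>
    have "witness y \<one> 1 (\<lambda>_. \<one>) (\<lambda>_. S)"
      using chain_one S_in_nontriv_subgroups S_closed subgroup.one_closed[OF Op_subgroup[OF S_subset]]
      by (simp add: witness_def partial_prod_def)
    then show ?case by blast
  next
    case (chain_step y w R z)
    note R = nontriv_subgroupsD[OF chain_step.hyps(2)] and w = chainD[OF chain_step.hyps(1)]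
    have z: "z \<in> normalizer G R" "z \<in> carrier G"
      using Op_subset_normalizer[OF R(3)] Op_closed[OF R(3)] chain_step.hyps(4) by auto
    obtain m x Q where W: "witness y w m x Q" using chain_step.IH by blast
    let ?x = "x(Suc m := z)" and ?Q = "Q(Suc m := R)"
    have pp: "partial_prod G ?x i = partial_prod G x i" if "i \<le> m" for i
      using that by (intro partial_prod_cong) auto
    have xc: "?x i \<in> carrier G" if "i \<in> {1..Suc m}" for i
      using that z(2) W by (auto simp: witness_def)
    have ppS: "partial_prod G ?x (Suc m) = w \<otimes> z"
      using partial_prod_Suc[of m ?x, OF xc] pp[of m] W by (simp add: witness_def)
    have "conj_elt G (conj_elt G y w) z \<in> R" using conj_elt_normalizer[OF R(3) z(1) chain_step.hyps(3)] .
    then have last: "conj_elt G y (w \<otimes> z) \<in> R" using w z S_closed by (simp add: conj_elt_conj_elt)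
    have mid: "conj_elt G y (partial_prod G ?x i) \<in> ?Q i \<inter> ?Q (i + 1)" if "i \<in> {1..<Suc m}" for i
    \<comment> \<open>At the junction i = m, membership in \<open>Q m\<close> is the extra condition
      of \<open>witness\<close>, and membership in R is the condition of the new chain step.\<close>
    proof (cases "i = m")
      case True
      then show ?thesis using W chain_step.hyps(3) pp[of m] by (auto simp: witness_def)
    next
      case False
      then show ?thesis using that W pp[of i] by (auto simp: witness_def)
    qed
    have "\<forall>i\<in>{1..Suc m}. ?Q i \<in> nontriv_subgroups G S" "\<forall>i\<in>{1..Suc m}. ?x i \<in> Op (?Q i)"
      using W chain_step.hyps by (auto simp: witness_def)
    then have "witness y (w \<otimes> z) (Suc m) ?x ?Q"
      using xc ppS last mid unfolding witness_def by auto
    then show ?case by blast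
  qed
  then obtain m x Q where W: "witness y g m x Q" by blast
  have "\<forall>i\<in>{1..m}. x i \<in> O_pprime p (normalizer_group G (Q i))"
    using W O_pprime_normalizer[OF nontriv_subgroupsD(3)] by (simp add: witness_def)
  then show ?thesis
    using W assms(2,3) S_closed[OF chainD(1)[OF assms(1)]] unfolding witness_def K_gens_def by blast
qed

lemma K_gens_iff: "g \<in> K_gens G p S \<longleftrightarrow> g \<in> normalizer G S \<and> (\<exists>y. y \<noteq> \<one> \<and> chain y g)"
  using chain_if_K_gens K_gens_if_chain by blast

section \<open>Normality of K and uniqueness of factorizations modulo K\<close>

abbreviation "K \<equiv> K_group G p S"

lemma inv_N: "h \<in> normalizer G S \<Longrightarrow> inv\<^bsub>N\<^esub> h = inv h"
  using m_inv_consistent[OF normalizer_subgroup[OF S_subset]] by simp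

text \<open>The generating set is itself invariant under N_G(S): conjugating a chain also conjugates
  its base point, which stays non-trivial. Since \<open>conj_elt\<close> is k^g, the conjugate g k
  g^{-1} uses \<open>inv g\<close>.\<close>

lemma K_normal: "K \<lhd> N"
  unfolding K_group_def
proof (rule group.normal_generateI[OF group_N])
  show "K_gens G p S \<subseteq> carrier N" by (auto simp: K_gens_def)
  fix k g assume k: "k \<in> K_gens G p S" and g: "g \<in> carrier N"
  then obtain y where y: "y \<noteq> \<one>" "chain y k" by (auto simp: K_gens_iff)
  have c: "y \<in> carrier G" "k \<in> normalizer G S" "k \<in> carrier G" "g \<in> carrier G"
    "inv g \<in> normalizer G S" "g \<in> normalizer G S"
    using k g y chainD S_closed normalizer_S_D(1) normalizer_S_closed by (auto simp: K_gens_iff)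
  have "chain (conj_elt G y (inv g)) (conj_elt G k (inv g))"
    using y(2) c(5) by (rule chain_conj)
  moreover have "conj_elt G y (inv g) \<noteq> \<one>" using y c by (simp add: conj_elt_eq_one_iff)
  moreover have "conj_elt G k (inv g) = g \<otimes> k \<otimes> inv g" using c by (simp add: conj_elt_def)
  moreover have "g \<otimes> k \<otimes> inv g \<in> normalizer G S" using c normalizer_S_closed by simp
  ultimately have "g \<otimes> k \<otimes> inv g \<in> K_gens G p S" unfolding K_gens_iff by metis
  then show "g \<otimes>\<^bsub>N\<^esub> k \<otimes>\<^bsub>N\<^esub> inv\<^bsub>N\<^esub> g \<in> K_gens G p S" using inv_N c by simp
qed

lemma K_subgroup: "subgroup K N"
  using K_normal by (rule normal_imp_subgroup)

text \<open>With w = x h^{-1} and w' = x h'^{-1}, the product w^{-1} w' = h h'^{-1} is a chain that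
  runs back along w to y and then along w'. It lies in N_G(S), so it is a generator of K.\<close>

lemma factors_same_base_unique:
  assumes "factors y x h" "factors y x h'" "y \<noteq> \<one>"
  shows "K #>\<^bsub>N\<^esub> h = K #>\<^bsub>N\<^esub> h'"
proof -
  note x = factorsD[OF assms(1)] and h' = factorsD(2)[OF assms(2)]
  have c: "h \<in> carrier G" "h' \<in> carrier G" "y \<in> carrier G"
    using x h' normalizer_S_D(1) S_closed by auto
  have c1: "chain y (x \<otimes> inv h)" and c2: "chain y (x \<otimes> inv h')"
    using assms by (simp_all add: factors_def)
  let ?y = "conj_elt G y (x \<otimes> inv h)"
  have "chain ?y (inv (x \<otimes> inv h))" using c1 by (rule chain_inv)
  moreover have "conj_elt G ?y (inv (x \<otimes> inv h)) = y" using x c by (simp add: conj_elt_conj_elt)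
  ultimately have "chain ?y (inv (x \<otimes> inv h) \<otimes> (x \<otimes> inv h'))" using chain_trans c2 by metis
  also have "inv (x \<otimes> inv h) \<otimes> (x \<otimes> inv h') = h \<otimes> inv h'"
    using x c by (simp add: inv_mult_group m_assoc inv_mult_cancel)
  finally have "h \<otimes> inv h' \<in> K_gens G p S"
    using x h' c assms(3) normalizer_S_closed conj_elt_eq_one_iff[of y "x \<otimes> inv h"]
    by (auto simp: K_gens_iff intro: exI[of _ ?y])
  then have "h \<otimes> inv h' \<in> K" unfolding K_group_def by (rule generate.incl)
  then have "h \<otimes>\<^bsub>N\<^esub> inv\<^bsub>N\<^esub> h' \<in> K" using inv_N h' by simp
  then have "K #>\<^bsub>N\<^esub> (h \<otimes>\<^bsub>N\<^esub> inv\<^bsub>N\<^esub> h') = K"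
    using group.coset_join2[OF group_N _ K_subgroup] subgroup.mem_carrier[OF K_subgroup] by blast
  then show ?thesis
    using group.coset_mult_inv1[OF group_N] x(2) h' subgroup.subset[OF K_subgroup] by simp
qed

text \<open>The fusion theorem is applied to the intersection of S with its conjugate by x^{-1}, the
  largest subgroup of S that x conjugates into S. This yields one h for all base points.\<close>

lemma factors_exists:
  assumes x: "x \<in> carrier G" and nt: "\<exists>y\<in>S. y \<noteq> \<one> \<and> conj_elt G y x \<in> S"
  shows "\<exists>h. \<forall>y\<in>S. conj_elt G y x \<in> S \<longrightarrow> factors y x h"
proof -
  let ?R = "conj_set G S (inv x) \<inter> S"
  have R: "y \<in> ?R \<longleftrightarrow> y \<in> S \<and> conj_elt G y x \<in> S" for y
  proof -
    have "y \<in> conj_set G S (inv x) \<longleftrightarrow> conj_elt G y x \<in> S" if "y \<in> S"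
      using conj_elt_in_conj_set_iff[OF S_subset, of "conj_elt G y x" "inv x"] S_closed[OF that] x
      by (simp add: conj_elt_conj_elt)
    then show ?thesis by blast
  qed
  have "subgroup ?R G"
    using subgroups_Inter_pair subgroup_conj_set[OF S_subgroup] S_subgroup x by simp
  then have "?R \<in> nontriv_subgroups G S"
    using nt R unfolding nontriv_subgroups_def by blast
  moreover have "conj_set G ?R x \<subseteq> S"
    unfolding conj_set_def[of _ ?R] using R by blast
  ultimately show ?thesis using alperin_fusion[OF _ x] R by blast
qed

text \<open>Different base points are not compared directly: each factorization is compared, at its
  own base point, with the common \<open>h0\<close> of \<open>factors_exists\<close>.\<close>

lemma factors_unique:
  assumes "factors y x h" "factors y' x h'" "y \<noteq> \<one>" "y' \<noteq> \<one>"
  shows "K #>\<^bsub>N\<^esub> h = K #>\<^bsub>N\<^esub> h'"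
proof -
  note y = factorsD[OF assms(1)] and y' = factorsD[OF assms(2)]
  obtain h0 where "\<forall>y\<in>S. conj_elt G y x \<in> S \<longrightarrow> factors y x h0"
    using factors_exists[OF y(1)] y assms(3) by blast
  then have "factors y x h0" "factors y' x h0" using y y' by auto
  then show ?thesis using factors_same_base_unique assms by metis
qed

section \<open>The defining conditions in terms of base points\<close>

lemma inter_conj_set_ne_iff:
  assumes x: "x \<in> carrier G"
  shows "S \<inter> conj_set G S x \<noteq> {\<one>} \<longleftrightarrow> (\<exists>y\<in>S. y \<noteq> \<one> \<and> conj_elt G y x \<in> S)"
proof -
  have "\<one> \<in> S \<inter> conj_set G S x"
    using subgroup.one_closed[OF S_subgroup] subgroup.one_closed[OF subgroup_conj_set[OF S_subgroup x]]
    by blast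
  then have "S \<inter> conj_set G S x \<noteq> {\<one>} \<longleftrightarrow> (\<exists>z\<in>S \<inter> conj_set G S x. z \<noteq> \<one>)" by blast
  also have "\<dots> \<longleftrightarrow> (\<exists>y\<in>S. y \<noteq> \<one> \<and> conj_elt G y x \<in> S)"
    using x S_closed conj_elt_eq_one_iff by (auto simp: conj_set_def)
  finally show ?thesis .
qed

text \<open>Writing an element of the intersection as u^{xy} with u in S, its membership in S^y
  means that u^x is in S. So the condition says that u, u^x and u^{xy} all stay in S.\<close>

lemma inter_conj_set3_ne_iff:
  assumes x: "x \<in> carrier G" and y: "y \<in> carrier G"
  shows "S \<inter> conj_set G S y \<inter> conj_set G S (x \<otimes> y) \<noteq> {\<one>} \<longleftrightarrow>
    (\<exists>u\<in>S. u \<noteq> \<one> \<and> conj_elt G u x \<in> S \<and> conj_elt G u (x \<otimes> y) \<in> S)"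
proof -
  have "\<one> \<in> S \<inter> conj_set G S y \<inter> conj_set G S (x \<otimes> y)"
    using subgroup.one_closed[OF S_subgroup] subgroup.one_closed[OF subgroup_conj_set[OF S_subgroup]] x y
    by blast
  then have "S \<inter> conj_set G S y \<inter> conj_set G S (x \<otimes> y) \<noteq> {\<one>} \<longleftrightarrow>
      (\<exists>z\<in>S \<inter> conj_set G S y \<inter> conj_set G S (x \<otimes> y). z \<noteq> \<one>)" by blast
  also have "\<dots> \<longleftrightarrow> (\<exists>u\<in>S. conj_elt G u (x \<otimes> y) \<noteq> \<one> \<and> conj_elt G u (x \<otimes> y) \<in> S \<and>
      conj_elt G u (x \<otimes> y) \<in> conj_set G S y)"
    by (auto simp: conj_set_def)
  also have "\<dots> \<longleftrightarrow> (\<exists>u\<in>S. u \<noteq> \<one> \<and> conj_elt G u x \<in> S \<and> conj_elt G u (x \<otimes> y) \<in> S)"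
  proof (rule bex_cong[OF refl])
    fix u assume "u \<in> S"
    then have u: "u \<in> carrier G" by (rule S_closed)
    have "conj_elt G (conj_elt G u x) y \<in> conj_set G S y \<longleftrightarrow> conj_elt G u x \<in> S"
      using u x y S_subset by (intro conj_elt_in_conj_set_iff) auto
    then show "conj_elt G u (x \<otimes> y) \<noteq> \<one> \<and> conj_elt G u (x \<otimes> y) \<in> S \<and> conj_elt G u (x \<otimes> y) \<in> conj_set G S y
      \<longleftrightarrow> u \<noteq> \<one> \<and> conj_elt G u x \<in> S \<and> conj_elt G u (x \<otimes> y) \<in> S"
      using u x y by (auto simp: conj_elt_conj_elt conj_elt_eq_one_iff)
  qed
  finally show ?thesis .
qed

lemma weak_homs_iff:
  "(\<rho> :: 'a \<Rightarrow> 'k::field mat) \<in> weak_homs G p S n \<longleftrightarrow> \<rho> \<in> carrier G \<rightarrow>\<^sub>E carrier (GL n) \<and>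
    (\<forall>x\<in>carrier G. (\<forall>y\<in>S. y \<noteq> \<one> \<longrightarrow> conj_elt G y x \<notin> S) \<longrightarrow> \<rho> x = 1\<^sub>m n) \<and>
    (\<forall>x\<in>p_elements p G. (\<exists>Q\<in>nontriv_subgroups G S. x \<in> normalizer G Q) \<longrightarrow> \<rho> x = 1\<^sub>m n) \<and>
    (\<forall>x\<in>carrier G. \<forall>y\<in>carrier G.
      (\<exists>u\<in>S. u \<noteq> \<one> \<and> conj_elt G u x \<in> S \<and> conj_elt G u (x \<otimes> y) \<in> S) \<longrightarrow> \<rho> x * \<rho> y = \<rho> (x \<otimes> y))"
proof -
  have "S \<inter> conj_set G S x = {\<one>} \<longleftrightarrow> (\<forall>y\<in>S. y \<noteq> \<one> \<longrightarrow> conj_elt G y x \<notin> S)"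
    if "x \<in> carrier G" for x
    using inter_conj_set_ne_iff[OF that] by blast
  moreover have "p_elements p G \<subseteq> carrier G" by (auto simp: p_elements_def)
  ultimately show ?thesis
    unfolding weak_homs_def by (simp add: inter_conj_set3_ne_iff cong: ball_cong) blast
qed

lemma GL_simps:
  "x \<otimes>\<^bsub>GL n\<^esub> y = x * y" "\<one>\<^bsub>GL n\<^esub> = 1\<^sub>m n"
  by (simp_all add: GL_def units_of_def ring_mat_simps)

section \<open>Values of a given weak homomorphism\<close>

context
  fixes \<rho> :: "'a \<Rightarrow> 'k::field mat" and n :: nat
  assumes \<rho>: "\<rho> \<in> weak_homs G p S n"
begin

lemma weak_hom_mult:
  assumes "x \<in> carrier G" "y \<in> carrier G" "u \<in> S" "u \<noteq> \<one>" "conj_elt G u x \<in> S"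
    "conj_elt G u (x \<otimes> y) \<in> S"
  shows "\<rho> (x \<otimes> y) = \<rho> x * \<rho> y"
  using \<rho> assms unfolding weak_homs_iff by metis

lemma weak_hom_closed: "x \<in> carrier G \<Longrightarrow> \<rho> x \<in> carrier (GL n)"
  using \<rho> by (auto simp: weak_homs_iff)

text \<open>Any non-trivial u in Q remains in Q, hence in S, under N_G(Q), and so witnesses
  multiplicativity for every pair in N_G(Q).\<close>

lemma weak_hom_group_hom:
  assumes "Q \<in> nontriv_subgroups G S"
  shows "group_hom (normalizer_group G Q) (GL n) \<rho>"
proof -
  note Q = nontriv_subgroupsD[OF assms]
  have "\<rho> \<in> hom (normalizer_group G Q) (GL n)"
  proof (rule homI)
    fix x assume "x \<in> carrier (normalizer_group G Q)"
    then show "\<rho> x \<in> carrier (GL n)" using normalizer_closed[OF Q(3)] weak_hom_closed by simp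
  next
    fix x y assume "x \<in> carrier (normalizer_group G Q)" "y \<in> carrier (normalizer_group G Q)"
    then have xy: "x \<in> normalizer G Q" "y \<in> normalizer G Q" "x \<otimes> y \<in> normalizer G Q"
      using subgroup.m_closed[OF normalizer_subgroup[OF Q(3)]] by auto
    obtain u where u: "u \<in> Q" "u \<noteq> \<one>" using Q(5) by blast
    have "conj_elt G u x \<in> S" "conj_elt G u (x \<otimes> y) \<in> S"
      using conj_elt_normalizer[OF Q(3) _ u(1)] xy Q(2) by auto
    then have "\<rho> (x \<otimes> y) = \<rho> x * \<rho> y"
      using u Q(2) xy normalizer_closed[OF Q(3)] by (intro weak_hom_mult) auto
    then show "\<rho> (x \<otimes>\<^bsub>normalizer_group G Q\<^esub> y) = \<rho> x \<otimes>\<^bsub>GL n\<^esub> \<rho> y"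
      by (simp add: GL_simps)
  qed
  then show ?thesis
    using subgroup_imp_group[OF normalizer_subgroup[OF Q(3)]] group_GL
    by (simp add: group_hom_def group_hom_axioms_def)
qed

text \<open>The kernel of the homomorphism on N_G(Q) contains all p-elements, hence the subgroup
  that they generate.\<close>

lemma weak_hom_Op:
  assumes "Q \<in> nontriv_subgroups G S" "x \<in> Op Q"
  shows "\<rho> x = 1\<^sub>m n"
proof -
  note Q = nontriv_subgroupsD[OF assms(1)]
  interpret h: group_hom "normalizer_group G Q" "GL n" \<rho> using weak_hom_group_hom[OF assms(1)] .
  have "p_elements p (normalizer_group G Q) \<subseteq> kernel (normalizer_group G Q) (GL n) \<rho>"
    using \<rho> assms(1) by (auto simp: p_elements_normalizer[OF Q(3)] kernel_def GL_simps weak_homs_iff)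
  from h.G.generate_subgroup_incl[OF this h.subgroup_kernel]
  show ?thesis using assms(2) by (auto simp: Op_eq_generate_normalizer[OF Q(3)] kernel_def GL_simps)
qed

text \<open>The conjugates of y stay in S along the chain, so y witnesses multiplicativity whenever
  a factor is appended.\<close>

lemma weak_hom_chain: "chain y w \<Longrightarrow> y \<noteq> \<one> \<Longrightarrow> \<rho> w = 1\<^sub>m n"
proof (induction rule: chain.induct)
  case (chain_one y)
  interpret h: group_hom N "GL n" \<rho> using weak_hom_group_hom[OF S_in_nontriv_subgroups] .
  show ?case using h.hom_one by (simp add: GL_simps)
next
  case (chain_step y w Q x)
  have "\<rho> (w \<otimes> x) = \<rho> w * \<rho> x"
    using chainD[OF chain_step.hyps(1)] chainD[OF chain.chain_step[OF chain_step.hyps]] chain_step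
      Op_closed[OF nontriv_subgroupsD(3)[OF chain_step.hyps(2)]]
    by (intro weak_hom_mult[of w x y]) auto
  then show ?case using chain_step weak_hom_Op[OF chain_step.hyps(2,4)] by simp
qed

lemma weak_hom_factors:
  assumes "factors y x h" "y \<noteq> \<one>"
  shows "\<rho> x = \<rho> h"
proof -
  note x = factorsD[OF assms(1)]
  have c: "h \<in> carrier G" "x \<otimes> inv h \<in> carrier G" "(x \<otimes> inv h) \<otimes> h = x"
    using x normalizer_S_D(1) by (simp_all add: m_assoc)
  have "chain y (x \<otimes> inv h)" using assms by (simp add: factors_def)
  then have "\<rho> (x \<otimes> inv h) = 1\<^sub>m n" "conj_elt G y (x \<otimes> inv h) \<in> S"
    using weak_hom_chain assms(2) chainD by auto
  moreover have "\<rho> ((x \<otimes> inv h) \<otimes> h) = \<rho> (x \<otimes> inv h) * \<rho> h"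
    using x c assms(2) calculation(2) by (intro weak_hom_mult[of _ _ y]) auto
  moreover have "\<rho> h \<in> carrier_mat n n" using weak_hom_closed[OF c(1)] by (simp add: carrier_GL)
  ultimately show ?thesis using c by simp
qed

text \<open>The generators of K are chains with non-trivial base point, so K lies in the kernel of
  the restriction to N_G(S).\<close>

lemma weak_hom_coset:
  assumes "g \<in> normalizer G S" "h \<in> normalizer G S" "K #>\<^bsub>N\<^esub> g = K #>\<^bsub>N\<^esub> h"
  shows "\<rho> g = \<rho> h"
proof -
  interpret h: group_hom N "GL n" \<rho> using weak_hom_group_hom[OF S_in_nontriv_subgroups] .
  have "K_gens G p S \<subseteq> kernel N (GL n) \<rho>"
    using weak_hom_chain by (auto simp: K_gens_iff kernel_def GL_simps)
  then have K: "K \<subseteq> kernel N (GL n) \<rho>"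
    unfolding K_group_def by (rule h.G.generate_subgroup_incl[OF _ h.subgroup_kernel])
  have "g \<in> K #>\<^bsub>N\<^esub> h" using h.G.rcos_self[OF _ K_subgroup, of g] assms by simp
  then obtain k where "k \<in> K" "g = k \<otimes>\<^bsub>N\<^esub> h" unfolding r_coset_def by blast
  then show ?thesis
    using K assms(2) h.hom_mult[of k h] h.hom_closed[of h]
    by (auto simp: kernel_def GL_simps carrier_GL)
qed

end

section \<open>The two mutually inverse maps\<close>

definition descend :: "('a \<Rightarrow> 'c) \<Rightarrow> 'a set \<Rightarrow> 'c" where
  "descend \<rho> = (\<lambda>C\<in>carrier (N Mod K). \<rho> (SOME g. g \<in> normalizer G S \<and> K #>\<^bsub>N\<^esub> g = C))"

text \<open>The default value 1 applies exactly to those x that take no non-trivial element of S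
  into S, where a weak homomorphism is required to be trivial.\<close>

definition extend :: "nat \<Rightarrow> ('a set \<Rightarrow> 'k::field mat) \<Rightarrow> 'a \<Rightarrow> 'k mat" where
  "extend n \<phi> = (\<lambda>x\<in>carrier G. if \<exists>h y. y \<noteq> \<one> \<and> factors y x h
     then \<phi> (K #>\<^bsub>N\<^esub> (SOME h. \<exists>y. y \<noteq> \<one> \<and> factors y x h)) else 1\<^sub>m n)"

lemma coset_in_Mod: "g \<in> normalizer G S \<Longrightarrow> K #>\<^bsub>N\<^esub> g \<in> carrier (N Mod K)"
  by (simp add: carrier_FactGroup)

lemma descend_coset:
  assumes "\<rho> \<in> weak_homs G p S n" "g \<in> normalizer G S"
  shows "descend \<rho> (K #>\<^bsub>N\<^esub> g) = \<rho> g"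
proof -
  \<comment> \<open>The representative chosen by \<open>descend\<close>; by
    \<open>weak_hom_coset\<close> it has the same value as g.\<close>
  let ?h = "SOME h. h \<in> normalizer G S \<and> K #>\<^bsub>N\<^esub> h = K #>\<^bsub>N\<^esub> g"
  have "?h \<in> normalizer G S \<and> K #>\<^bsub>N\<^esub> ?h = K #>\<^bsub>N\<^esub> g" by (rule someI[of _ g]) (use assms in simp)
  then show ?thesis
    using weak_hom_coset[OF assms(1), of ?h g] assms(2) coset_in_Mod by (simp add: descend_def)
qed

lemma Mod_mult:
  "g \<in> normalizer G S \<Longrightarrow> h \<in> normalizer G S \<Longrightarrow>
    (K #>\<^bsub>N\<^esub> g) \<otimes>\<^bsub>N Mod K\<^esub> (K #>\<^bsub>N\<^esub> h) = K #>\<^bsub>N\<^esub> (g \<otimes> h)"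
  using normal.rcos_sum[OF K_normal, of g h] by (simp add: FactGroup_def)

lemma descend_Hom:
  assumes \<rho>: "\<rho> \<in> weak_homs G p S n"
  shows "descend \<rho> \<in> Hom (N Mod K) (GL n)"
proof -
  interpret h: group_hom N "GL n" \<rho> using weak_hom_group_hom[OF \<rho> S_in_nontriv_subgroups] .
  have "descend \<rho> \<in> hom (N Mod K) (GL n)"
  proof (rule homI)
    fix C assume "C \<in> carrier (N Mod K)"
    then show "descend \<rho> C \<in> carrier (GL n)"
      using descend_coset[OF \<rho>] h.hom_closed by (auto simp: carrier_FactGroup)
  next
    fix C D assume "C \<in> carrier (N Mod K)" "D \<in> carrier (N Mod K)"
    then obtain g k where gk: "g \<in> normalizer G S" "C = K #>\<^bsub>N\<^esub> g" "k \<in> normalizer G S" "D = K #>\<^bsub>N\<^esub> k"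
      by (auto simp: carrier_FactGroup)
    then show "descend \<rho> (C \<otimes>\<^bsub>N Mod K\<^esub> D) = descend \<rho> C \<otimes>\<^bsub>GL n\<^esub> descend \<rho> D"
      using h.hom_mult[of g k] normalizer_S_closed(2)[of g k] Mod_mult[of g k]
        descend_coset[OF \<rho>] by (simp del: mult_FactGroup)
  qed
  then show ?thesis by (simp add: Hom_def descend_def)
qed

text \<open>Any factorization of x may replace the chosen one, since by
  \<open>factors_unique\<close> both give the same coset of K.\<close>

lemma extend_factors:
  assumes "factors y x h" "y \<noteq> \<one>"
  shows "extend n \<phi> x = \<phi> (K #>\<^bsub>N\<^esub> h)"
proof -
  have ex: "\<exists>h y. y \<noteq> \<one> \<and> factors y x h" using assms by blast
  obtain z where "z \<noteq> \<one>" "factors z x (SOME h. \<exists>y. y \<noteq> \<one> \<and> factors y x h)"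
    using someI_ex[OF ex] by blast
  then show ?thesis
    using factors_unique[OF _ assms(1) _ assms(2)] ex factorsD(1)[OF assms(1)] by (simp add: extend_def)
qed

lemma extend_eq_one:
  assumes "x \<in> carrier G" "\<forall>y\<in>S. y \<noteq> \<one> \<longrightarrow> conj_elt G y x \<notin> S"
  shows "extend n \<phi> x = 1\<^sub>m n"
  using assms factorsD(3,4) unfolding extend_def by (auto split: if_splits)

lemma extend_weak_hom:
  fixes \<phi> :: "'a set \<Rightarrow> 'k::field mat"
  assumes \<phi>: "\<phi> \<in> Hom (N Mod K) (GL n)"
  shows "extend n \<phi> \<in> weak_homs G p S n"
proof -
  have GMod: "group (N Mod K)" by (rule normal.factorgroup_is_group[OF K_normal])
  interpret \<phi>: group_hom "N Mod K" "GL n" \<phi>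
    using \<phi> GMod group_GL by (simp add: Hom_def group_hom_def group_hom_axioms_def)
  have one: "\<phi> (K #>\<^bsub>N\<^esub> \<one>) = 1\<^sub>m n"
    using \<phi>.hom_one group.coset_mult_one[OF group_N subgroup.subset[OF K_subgroup]]
    by (simp add: GL_simps)
  have fact: "\<exists>h. factors y x h" if "y \<in> S" "y \<noteq> \<one>" "x \<in> carrier G" "conj_elt G y x \<in> S" for x y
    using factors_exists[OF that(3)] that by blast
  show ?thesis
    unfolding weak_homs_iff
  proof (intro conjI ballI impI)
    show "extend n \<phi> \<in> carrier G \<rightarrow>\<^sub>E carrier (GL n)"
    proof (rule PiE_I)
      fix x assume x: "x \<in> carrier G"
      show "extend n \<phi> x \<in> carrier (GL n)"
      proof (cases "\<exists>y\<in>S. y \<noteq> \<one> \<and> conj_elt G y x \<in> S")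
        case True
        then obtain y h where "y \<noteq> \<one>" "factors y x h" using fact x by blast
        then show ?thesis
          using extend_factors factorsD(2) coset_in_Mod \<phi>.hom_closed by metis
      next
        case False
        then show ?thesis
          using extend_eq_one[OF x] group.is_monoid[OF group_GL] monoid.one_closed GL_simps(2) by metis
      qed
    qed (simp add: extend_def)
  next
    fix x assume "x \<in> carrier G" "\<forall>y\<in>S. y \<noteq> \<one> \<longrightarrow> conj_elt G y x \<notin> S"
    then show "extend n \<phi> x = 1\<^sub>m n" by (rule extend_eq_one)
  next
    fix x assume x: "x \<in> p_elements p G" and "\<exists>Q\<in>nontriv_subgroups G S. x \<in> normalizer G Q"
    then obtain Q where Q: "Q \<in> nontriv_subgroups G S" "x \<in> normalizer G Q" by blast
    obtain y where y: "y \<in> Q" "y \<noteq> \<one>" using nontriv_subgroupsD(5)[OF Q(1)] by blast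
    have "x \<in> Op Q" unfolding Op_def using x Q(2) by (simp add: generate.incl)
    then show "extend n \<phi> x = 1\<^sub>m n"
      using extend_factors[OF factors_Op[OF Q(1) y(1)] y(2)] one by metis
  next
    fix x y assume x: "x \<in> carrier G" and y: "y \<in> carrier G"
      and "\<exists>u\<in>S. u \<noteq> \<one> \<and> conj_elt G u x \<in> S \<and> conj_elt G u (x \<otimes> y) \<in> S"
    then obtain u where u: "u \<in> S" "u \<noteq> \<one>" "conj_elt G u x \<in> S" "conj_elt G u (x \<otimes> y) \<in> S" by blast
    have uG: "u \<in> carrier G" using u(1) by (rule S_closed)
    obtain h where h: "factors u x h" using fact u x by blast
    have ux: "conj_elt G u x \<noteq> \<one>" using u(2) uG x by (simp add: conj_elt_eq_one_iff)
    \<comment> \<open>The factorization of y is based at u^x, where that of x ends, so that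
      \<open>factors_mult\<close> gives h k for the product.\<close>
    obtain k where k: "factors (conj_elt G u x) y k"
      using fact[OF u(3) ux y] u(4) uG x y by (auto simp: conj_elt_conj_elt)
    have hk: "h \<in> normalizer G S" "k \<in> normalizer G S" using factorsD(2) h k by auto
    have "extend n \<phi> x * extend n \<phi> y = \<phi> (K #>\<^bsub>N\<^esub> h) \<otimes>\<^bsub>GL n\<^esub> \<phi> (K #>\<^bsub>N\<^esub> k)"
      by (simp add: extend_factors[OF h u(2)] extend_factors[OF k ux] GL_simps)
    also have "\<dots> = \<phi> (K #>\<^bsub>N\<^esub> (h \<otimes> k))"
      using \<phi>.hom_mult[OF coset_in_Mod[OF hk(1)] coset_in_Mod[OF hk(2)]] Mod_mult[OF hk] by simp
    also have "\<dots> = extend n \<phi> (x \<otimes> y)"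
      by (rule extend_factors[OF factors_mult[OF h k] u(2), symmetric])
    finally show "extend n \<phi> x * extend n \<phi> y = extend n \<phi> (x \<otimes> y)" .
  qed
qed

lemma extend_descend:
  assumes \<rho>: "\<rho> \<in> weak_homs G p S n"
  shows "extend n (descend \<rho>) = \<rho>"
proof
  fix x
  consider "x \<notin> carrier G" | "x \<in> carrier G" "\<forall>y\<in>S. y \<noteq> \<one> \<longrightarrow> conj_elt G y x \<notin> S"
    | "x \<in> carrier G" "\<exists>y\<in>S. y \<noteq> \<one> \<and> conj_elt G y x \<in> S" by blast
  then show "extend n (descend \<rho>) x = \<rho> x"
  proof cases
    case 1
    then show ?thesis using \<rho> by (auto simp: weak_homs_iff extend_def PiE_def extensional_def)
  next
    case 2
    then show ?thesis using \<rho> by (simp add: extend_eq_one weak_homs_iff)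
  next
    case 3
    then obtain y h where yh: "y \<noteq> \<one>" "factors y x h" using factors_exists by blast
    then show ?thesis
      using extend_factors[OF yh(2,1)] descend_coset[OF \<rho> factorsD(2)[OF yh(2)]]
        weak_hom_factors[OF \<rho> yh(2,1)] by metis
  qed
qed

lemma descend_extend:
  assumes \<phi>: "\<phi> \<in> Hom (N Mod K) (GL n)"
  shows "descend (extend n \<phi>) = \<phi>"
proof
  fix C
  show "descend (extend n \<phi>) C = \<phi> C"
  proof (cases "C \<in> carrier (N Mod K)")
    case True
    then obtain g where g: "g \<in> normalizer G S" "C = K #>\<^bsub>N\<^esub> g" by (auto simp: carrier_FactGroup)
    \<comment> \<open>Any non-trivial base point in S will do: g lies in N_G(S), so it factors with
      h = g.\<close>
    obtain y where "y \<in> S" "y \<noteq> \<one>" using nontriv_subgroupsD(5)[OF S_in_nontriv_subgroups] by blast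
    then have "extend n \<phi> g = \<phi> C" using extend_factors[OF factors_normalizer] g by metis
    then show ?thesis using descend_coset[OF extend_weak_hom[OF \<phi>] g(1)] g(2) by simp
  next
    case False
    then show ?thesis using \<phi> by (simp add: descend_def Hom_def extensional_def)
  qed
qed

lemma bij_betw_descend:
  "bij_betw descend (weak_homs G p S n :: ('a \<Rightarrow> 'k::field mat) set) (Hom (N Mod K) (GL n))"
  by (rule bij_betw_byWitness[where f' = "extend n"])
     (auto simp: extend_descend descend_extend descend_Hom extend_weak_hom)

end

theorem theorem3p2:
  fixes G :: "('a, 'b) monoid_scheme" and p n :: nat and S :: "'a set"
  assumes "group G" and "finite (carrier G)"
    and "prime p" and "p dvd order G"
    and "CHAR('k::alg_closed_field) = p"
    and "sylow_subgroup p G S"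
    and "n \<ge> 1"
  shows "K_group G p S \<lhd> normalizer_group G S \<and>
    (\<exists>\<Phi>. bij_betw \<Phi> (weak_homs G p S n :: ('a \<Rightarrow> 'k mat) set)
                       (Hom (normalizer_group G S Mod K_group G p S) (GL n)) \<and>
         (\<forall>\<rho> \<in> weak_homs G p S n. \<forall>g \<in> normalizer G S.
            \<Phi> \<rho> (K_group G p S #>\<^bsub>normalizer_group G S\<^esub> g) = \<rho> g))"
proof -
  interpret sylow_pair G p S
    using assms by (intro sylow_pair.intro sylow_pair_axioms.intro)
  show ?thesis using K_normal bij_betw_descend descend_coset by blast
qed

end
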